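(* Let $M$ be a loopless realizable matroid of rank $r\geq 1$ on $n$ elements. Then $$\operatorname{shRVol}(M) \leq \operatorname{shRVol}(U_{r,n}) = n^{r-1},$$ with equality if and only if $M = U_{r,n}$.
   Context: A matroid is realizable if it is the matroid of a finite list of vectors in a vector space over some field (which may be taken algebraically closed). $U_{r,n}$ is the uniform matroid of rank $r$ on $n$ elements. For a loopless matroid $M$ of rank $d+1$ on $E$ (loopless: $\emptyset$ is a flat), $\mathscr L_M$ is the lattice of flats and $\overline{\mathscr L_M} := \mathscr L_M\setminus\{\emptyset,E\}$. The Chow ring of $M$ is the graded ring $$A^\bullet(M) := \mathbb R[x_F : F\in \overline{\mathscr L_M}]/(\mathcal I_M+\mathcal J_M),$$ where $\mathcal I_M = (x_Fx_{F'} : F,F' \text{ incomparable})$ and $\mathcal J_M = (\sum_{F\ni i}x_F - \sum_{G\ni j}x_G : i,j\in E)$, sums over flats in $\overline{\mathscr L_M}$. By a known theorem of Adiprasito–Huh–Katz there is a unique linear isomorphism $\deg_M: A^d(M)\to\mathbb R$ with $\deg_M(x_{G_1}\cdots x_{G_d})=1$ for every maximal chain $G_1\subsetneq\cdots\subsetneq G_d$ in $\overline{\mathscr L_M}$. The shifted rank volume of $M$ is $$\operatorname{shRVol}(M) := \deg_M\Big(\sum_{F\in\overline{\mathscr L_M}}(\operatorname{rk}_M F)\,x_F\Big)^{\operatorname{rk}M-1}.$$ *)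

theory Defs
  imports "HOL-Algebra.QuotRing" "HOL-Library.Poly_Mapping" Complex_Main
begin

section \<open>Polynomial rings over the reals in a set of variables\<close>

text \<open>A polynomial in variables of type \<open>'v\<close> is a finitely supported map from monomials to
  coefficients, a monomial being a finitely supported exponent function. The operations of
  \<open>HOL-Library.Poly_Mapping\<close> on this type are those of the polynomial ring.\<close>

type_synonym 'v mpoly = "('v \<Rightarrow>\<^sub>0 nat) \<Rightarrow>\<^sub>0 real"

definition poly_const :: "real \<Rightarrow> 'v mpoly" where
  "poly_const c = Poly_Mapping.single 0 c"

definition poly_var :: "'v \<Rightarrow> 'v mpoly" where
  "poly_var x = Poly_Mapping.single (Poly_Mapping.single x 1) 1"

definition poly_ring :: "'v set \<Rightarrow> 'v mpoly ring" where
  "poly_ring V =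
    \<lparr>carrier = {p. \<forall>m\<in>Poly_Mapping.keys p. Poly_Mapping.keys m \<subseteq> V},
     mult = (*), one = 1, zero = 0, add = (+)\<rparr>"

definition homogeneous :: "nat \<Rightarrow> 'v mpoly \<Rightarrow> bool" where
  "homogeneous k p \<longleftrightarrow>
    (\<forall>m\<in>Poly_Mapping.keys p. (\<Sum>x\<in>Poly_Mapping.keys m. Poly_Mapping.lookup m x) = k)"

lemma poly_ring_cring: "cring (poly_ring (V :: 'v set))"
proof (rule cringI)
  show "abelian_group (poly_ring V)"
  proof (rule abelian_groupI)
    fix x y :: "'v mpoly"
    assume "x \<in> carrier (poly_ring V)" "y \<in> carrier (poly_ring V)"
    then show "x \<oplus>\<^bsub>poly_ring V\<^esub> y \<in> carrier (poly_ring V)"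
      using Poly_Mapping.keys_add[of x y] by (auto simp: poly_ring_def)
  next
    fix x :: "'v mpoly"
    assume "x \<in> carrier (poly_ring V)"
    then show "\<exists>y\<in>carrier (poly_ring V). y \<oplus>\<^bsub>poly_ring V\<^esub> x = \<zero>\<^bsub>poly_ring V\<^esub>"
      by (intro bexI[of _ "- x"]) (auto simp: poly_ring_def)
  qed (auto simp: poly_ring_def algebra_simps)
  show "comm_monoid (poly_ring V)"
  proof (rule comm_monoidI)
    fix x y :: "'v mpoly"
    assume *: "x \<in> carrier (poly_ring V)" "y \<in> carrier (poly_ring V)"
    have "Poly_Mapping.keys m \<subseteq> V" if m: "m \<in> Poly_Mapping.keys (x * y)" for m
    proof -
      obtain a b where "m = a + b" "a \<in> Poly_Mapping.keys x" "b \<in> Poly_Mapping.keys y"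
        using subsetD[OF Poly_Mapping.keys_mult m] by auto
      then show ?thesis
        using * Poly_Mapping.keys_add[of a b] by (fastforce simp: poly_ring_def)
    qed
    then show "x \<otimes>\<^bsub>poly_ring V\<^esub> y \<in> carrier (poly_ring V)"
      by (auto simp: poly_ring_def)
  qed (auto simp: poly_ring_def algebra_simps)
qed (auto simp: poly_ring_def algebra_simps)

section \<open>Matroids\<close>

locale matroid =
  fixes E :: "'a set" and Ind :: "'a set set"
  assumes finite_ground: "finite E"
    and indep_subset_ground: "X \<in> Ind \<Longrightarrow> X \<subseteq> E"
    and indep_empty: "{} \<in> Ind"
    and indep_subset: "X \<in> Ind \<Longrightarrow> Y \<subseteq> X \<Longrightarrow> Y \<in> Ind"
    and indep_augment: "X \<in> Ind \<Longrightarrow> Y \<in> Ind \<Longrightarrow> card X < card Y \<Longrightarrow>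
      \<exists>y\<in>Y - X. insert y X \<in> Ind"
begin

definition rk :: "'a set \<Rightarrow> nat" where
  "rk X = Max {card Y |Y. Y \<in> Ind \<and> Y \<subseteq> X}"

definition flat :: "'a set \<Rightarrow> bool" where
  "flat F \<longleftrightarrow> F \<subseteq> E \<and> (\<forall>x\<in>E - F. rk F < rk (insert x F))"

definition loopless :: bool where
  "loopless \<longleftrightarrow> flat {}"

definition proper_flats :: "'a set set" where
  "proper_flats = {F. flat F} - {{}, E}"

text \<open>From here on the definitions are meant for loopless matroids of positive rank.\<close>

definition incomparable_gens :: "'a set mpoly set" where
  "incomparable_gens = {poly_var F * poly_var G |F G.
     F \<in> proper_flats \<and> G \<in> proper_flats \<and> \<not> F \<subseteq> G \<and> \<not> G \<subseteq> F}"

definition linear_gens :: "'a set mpoly set" where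
  "linear_gens =
    {(\<Sum>F\<in>{F\<in>proper_flats. i \<in> F}. poly_var F) - (\<Sum>G\<in>{G\<in>proper_flats. j \<in> G}. poly_var G)
     |i j. i \<in> E \<and> j \<in> E}"

definition flat_ring :: "'a set mpoly ring" where
  "flat_ring = poly_ring proper_flats"

definition chow_ideal :: "'a set mpoly set" where
  "chow_ideal = Idl\<^bsub>flat_ring\<^esub> incomparable_gens <+>\<^bsub>flat_ring\<^esub> Idl\<^bsub>flat_ring\<^esub> linear_gens"

definition chow_ring :: "'a set mpoly set ring" where
  "chow_ring = flat_ring Quot chow_ideal"

definition chow_class :: "'a set mpoly \<Rightarrow> 'a set mpoly set" where
  "chow_class p = chow_ideal +>\<^bsub>flat_ring\<^esub> p"

definition chow_scale :: "real \<Rightarrow> 'a set mpoly set \<Rightarrow> 'a set mpoly set" where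
  "chow_scale c a = chow_class (poly_const c) \<otimes>\<^bsub>chow_ring\<^esub> a"

definition chow_graded :: "nat \<Rightarrow> 'a set mpoly set set" where
  "chow_graded k = chow_class ` {p \<in> carrier flat_ring. homogeneous k p}"

text \<open>The defining properties of the degree map on the top graded piece. Maximal chains are
  taken in the set of proper flats ordered by inclusion and represented by their sets of members.
  Extensionality only fixes the irrelevant values outside that piece, so that the map is unique as
  a HOL function.\<close>

definition is_degree_map :: "('a set mpoly set \<Rightarrow> real) \<Rightarrow> bool" where
  "is_degree_map f \<longleftrightarrow>
    (let A = chow_graded (rk E - 1) in
      f \<in> extensional A \<and> bij_betw f A UNIV \<and>
      (\<forall>a\<in>A. \<forall>b\<in>A. f (a \<oplus>\<^bsub>chow_ring\<^esub> b) = f a + f b) \<and>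
      (\<forall>c. \<forall>a\<in>A. f (chow_scale c a) = c * f a) \<and>
      (\<forall>C. subset.maxchain proper_flats C \<longrightarrow>
        f (\<Otimes>\<^bsub>chow_ring\<^esub>G\<in>C. chow_class (poly_var G)) = 1))"

definition deg :: "'a set mpoly set \<Rightarrow> real" where
  "deg = (THE f. is_degree_map f)"

definition shRVol :: real where
  "shRVol = deg ((\<Oplus>\<^bsub>chow_ring\<^esub>F\<in>proper_flats. chow_scale (real (rk F)) (chow_class (poly_var F)))
                  [^]\<^bsub>chow_ring\<^esub> (rk E - 1))"

end

text \<open>The independent sets of the uniform matroid of rank \<open>r\<close> on \<open>E\<close>, where \<open>r \<le> card E\<close>.\<close>

definition uniform :: "nat \<Rightarrow> 'a set \<Rightarrow> 'a set set" where
  "uniform r E = {X. X \<subseteq> E \<and> card X \<le> r}"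

lemma matroid_uniform:
  assumes "finite E"
  shows "matroid E (uniform r E)"
proof
  fix X Y :: "'a set"
  assume X: "X \<in> uniform r E" and Y: "Y \<in> uniform r E" and less: "card X < card Y"
  have fin: "finite X" "finite Y"
    using X Y assms by (auto simp: uniform_def intro: finite_subset)
  then have "\<not> Y \<subseteq> X"
    using less card_mono[of X Y] by linarith
  then obtain y where y: "y \<in> Y - X" by blast
  then have "insert y X \<in> uniform r E"
    using X Y fin less by (auto simp: uniform_def)
  with y show "\<exists>y\<in>Y - X. insert y X \<in> uniform r E" by blast
next
  fix X Y :: "'a set"
  assume "X \<in> uniform r E" "Y \<subseteq> X"
  then show "Y \<in> uniform r E"
    using assms card_mono[of X Y] finite_subset[of X E] by (fastforce simp: uniform_def)
qed (use assms in \<open>auto simp: uniform_def\<close>)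

text \<open>\<open>v\<close> is a list of vectors indexed by the ground set. The members of \<open>X\<close> index a linearly
  independent list iff \<open>v\<close> is injective on \<open>X\<close> and the vectors form an independent set.\<close>

definition vector_matroid ::
    "('k::field \<Rightarrow> 'v::ab_group_add \<Rightarrow> 'v) \<Rightarrow> 'a set \<Rightarrow> ('a \<Rightarrow> 'v) \<Rightarrow> 'a set set" where
  "vector_matroid scale E v = {X. X \<subseteq> E \<and> inj_on v X \<and> \<not> module.dependent scale (v ` X)}"

text \<open>Realizability in the vector space with the given scalar multiplication. HOL cannot quantify
  existentially over the field and the space; a theorem assuming this predicate with \<open>'k\<close>, \<open>'v\<close> and
  \<open>scale\<close> arbitrary is a statement about all realizable matroids.\<close>

definition realizable_in ::
    "('k::field \<Rightarrow> 'v::ab_group_add \<Rightarrow> 'v) \<Rightarrow> 'a set \<Rightarrow> 'a set set \<Rightarrow> bool" where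
  "realizable_in scale E Ind \<longleftrightarrow> vector_space scale \<and> (\<exists>v. Ind = vector_matroid scale E v)"

end

theory Submission
  imports Defs "HOL-Library.Multiset"
begin

text \<open>
  Write \<open>d = rk E - 1\<close>.

  Existence of the degree map. Introduce new generators \<open>h\<^sub>T\<close> for the subsets \<open>T\<close> of \<open>E\<close> with
  \<open>h\<^sub>T = - (\<Sum>S\<supseteq>T. x\<^sub>S)\<close>, and send a product \<open>h\<^sub>T\<^sub>1 \<dots> h\<^sub>T\<^sub>d\<close> to 1 if every nonempty
  subfamily of \<open>T\<^sub>1, \<dots>, T\<^sub>d\<close> has a union of rank greater than its number of members (the dragon
  Hall-Rado condition of Backman, Eur and Simpson), and to 0 otherwise. The linear relations hold
  since \<open>h\<^sub>{\<^sub>i\<^sub>}\<close> acts as zero, and \<open>x\<^sub>S x\<^sub>S\<^sub>'\<close> acts as zero for incomparable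
  \<open>S\<close>, \<open>S'\<close> because a second difference of the weight vanishes by submodularity. Uniqueness: with
  \<open>\<alpha> = h\<^sub>E\<close>, every product of \<open>d\<close> variables is congruent to a multiple of \<open>\<alpha>^d\<close>.

  The inequality. Let \<open>D = (\<Sum>F. rk F * x\<^sub>F)\<close>. In the uniform matroid \<open>D = n \<alpha>\<close>. Otherwise there is
  a dependent set \<open>C\<close> with at most \<open>rk E\<close> elements, and \<open>D' = (\<Sum>F. (card F - of_bool (C \<subseteq> F)) * x\<^sub>F)\<close>
  equals \<open>(n - 1) \<alpha> + h\<^sub>C\<close> in the Chow ring. The difference \<open>D' - D\<close> is effective and multiplication
  by \<open>D\<close> and \<open>D'\<close> preserves nonnegative combinations of chains of flats, so the degree of \<open>D^d\<close> is
  at most that of \<open>D'^d\<close>. Expanding the latter, each \<open>\<alpha>^(d-j) h\<^sub>C^j\<close> has degree 0 or 1, and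
  \<open>h\<^sub>C^d\<close> has degree 0; hence the degree is less than \<open>((n - 1) + 1)^d\<close>.
\<close>

section \<open>Linear and multiplicative extension on monoid algebras\<close>

definition lin_ext :: "('k \<Rightarrow> real) \<Rightarrow> ('k \<Rightarrow>\<^sub>0 real) \<Rightarrow> real" where
  "lin_ext f p = (\<Sum>k\<in>Poly_Mapping.keys p. Poly_Mapping.lookup p k * f k)"

lemma lin_ext_zero [simp]: "lin_ext f 0 = 0"
  by (simp add: lin_ext_def)

lemma lin_ext_add: "lin_ext f (p + q) = lin_ext f p + lin_ext f q"
  unfolding lin_ext_def
  by (rule setsum_keys_plus_distrib[of "\<lambda>k c. c * f k"]) (auto simp: algebra_simps)

lemma lin_ext_sum: "lin_ext f (sum p A) = (\<Sum>a\<in>A. lin_ext f (p a))"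
  by (induction A rule: infinite_finite_induct) (auto simp: lin_ext_add)

lemma lin_ext_single [simp]: "lin_ext f (Poly_Mapping.single k c) = c * f k"
  by (cases "c = 0") (auto simp: lin_ext_def)

lemma lin_ext_minus: "lin_ext f (- p) = - lin_ext f p"
  using lin_ext_add[of f p "- p"] by simp

lemma lin_ext_diff: "lin_ext f (p - q) = lin_ext f p - lin_ext f q"
  using lin_ext_add[of f p "- q"] by (simp add: lin_ext_minus)

lemma poly_mapping_sum_singles:
  "p = (\<Sum>k\<in>Poly_Mapping.keys p. Poly_Mapping.single k (Poly_Mapping.lookup p k))"
proof (rule poly_mapping_eqI)
  fix k
  show "Poly_Mapping.lookup p k =
    Poly_Mapping.lookup (\<Sum>k\<in>Poly_Mapping.keys p. Poly_Mapping.single k (Poly_Mapping.lookup p k)) k"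
    by (simp add: lookup_sum lookup_single when_def in_keys_iff)
qed

definition alg_ext :: "('k \<Rightarrow> ('l::comm_monoid_add \<Rightarrow>\<^sub>0 real)) \<Rightarrow> ('k \<Rightarrow>\<^sub>0 real) \<Rightarrow> ('l \<Rightarrow>\<^sub>0 real)" where
  "alg_ext \<phi> p = (\<Sum>k\<in>Poly_Mapping.keys p. Poly_Mapping.single 0 (Poly_Mapping.lookup p k) * \<phi> k)"

lemma alg_ext_add: "alg_ext \<phi> (p + q) = alg_ext \<phi> p + alg_ext \<phi> q"
  unfolding alg_ext_def
  by (rule setsum_keys_plus_distrib[of "\<lambda>k c. Poly_Mapping.single 0 c * \<phi> k"])
    (auto simp: single_add algebra_simps)

lemma alg_ext_zero [simp]: "alg_ext \<phi> 0 = 0"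
  by (simp add: alg_ext_def)

lemma alg_ext_sum: "alg_ext \<phi> (sum p A) = (\<Sum>a\<in>A. alg_ext \<phi> (p a))"
  by (induction A rule: infinite_finite_induct) (auto simp: alg_ext_add)

lemma alg_ext_single [simp]: "alg_ext \<phi> (Poly_Mapping.single k c) = Poly_Mapping.single 0 c * \<phi> k"
  by (cases "c = 0") (auto simp: alg_ext_def)

lemma alg_ext_diff: "alg_ext \<phi> (p - q) = alg_ext \<phi> p - alg_ext \<phi> q"
  using alg_ext_add[of \<phi> "p - q" q] by simp

text \<open>Both sides are bilinear, so the identity reduces to products of two single monomials,
  where it is the multiplicativity of \<open>\<phi>\<close>.\<close>

lemma alg_ext_mult:
  fixes \<phi> :: "'k::comm_monoid_add \<Rightarrow> ('l::comm_monoid_add \<Rightarrow>\<^sub>0 real)"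
  assumes "\<And>a b. \<phi> (a + b) = \<phi> a * \<phi> b"
  shows "alg_ext \<phi> (p * q) = alg_ext \<phi> p * alg_ext \<phi> q"
proof -
  have 1: "alg_ext \<phi> (Poly_Mapping.single a c * Poly_Mapping.single b e) =
      alg_ext \<phi> (Poly_Mapping.single a c) * alg_ext \<phi> (Poly_Mapping.single b e)" for a b c e
  proof -
    have "alg_ext \<phi> (Poly_Mapping.single a c * Poly_Mapping.single b e) =
        Poly_Mapping.single (0 + 0) (c * e) * (\<phi> a * \<phi> b)"
      by (simp add: mult_single assms)
    also have "\<dots> = (Poly_Mapping.single 0 c * Poly_Mapping.single 0 e) * (\<phi> a * \<phi> b)"
      by (simp only: mult_single)
    also have "\<dots> = (Poly_Mapping.single 0 c * \<phi> a) * (Poly_Mapping.single 0 e * \<phi> b)"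
      by (simp only: ac_simps)
    finally show ?thesis by simp
  qed
  have "alg_ext \<phi> (p * q) = alg_ext \<phi>
      ((\<Sum>k\<in>Poly_Mapping.keys p. Poly_Mapping.single k (Poly_Mapping.lookup p k)) *
       (\<Sum>k\<in>Poly_Mapping.keys q. Poly_Mapping.single k (Poly_Mapping.lookup q k)))"
    using poly_mapping_sum_singles[of p] poly_mapping_sum_singles[of q] by simp
  also have "\<dots> = alg_ext \<phi> (\<Sum>k\<in>Poly_Mapping.keys p. Poly_Mapping.single k (Poly_Mapping.lookup p k)) *
       alg_ext \<phi> (\<Sum>k\<in>Poly_Mapping.keys q. Poly_Mapping.single k (Poly_Mapping.lookup q k))"
    unfolding sum_product alg_ext_sum 1 ..
  also have "\<dots> = alg_ext \<phi> p * alg_ext \<phi> q"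
    using poly_mapping_sum_singles[of p] poly_mapping_sum_singles[of q] by simp
  finally show ?thesis .
qed

section \<open>Substitution of algebra elements for variables\<close>

definition subst_mono ::
    "('v \<Rightarrow> ('l::comm_monoid_add \<Rightarrow>\<^sub>0 real)) \<Rightarrow> ('v \<Rightarrow>\<^sub>0 nat) \<Rightarrow> ('l \<Rightarrow>\<^sub>0 real)" where
  "subst_mono X m = (\<Prod>v\<in>Poly_Mapping.keys m. X v ^ Poly_Mapping.lookup m v)"

lemma subst_mono_superset:
  assumes "finite A" "Poly_Mapping.keys m \<subseteq> A"
  shows "subst_mono X m = (\<Prod>v\<in>A. X v ^ Poly_Mapping.lookup m v)"
  unfolding subst_mono_def using assms
  by (intro prod.mono_neutral_left) (auto simp: in_keys_iff)

lemma subst_mono_add: "subst_mono X (a + b) = subst_mono X a * subst_mono X b"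
proof -
  let ?A = "Poly_Mapping.keys a \<union> Poly_Mapping.keys b"
  have "subst_mono X (a + b) = (\<Prod>v\<in>?A. X v ^ Poly_Mapping.lookup (a + b) v)"
    by (rule subst_mono_superset) (auto simp: Poly_Mapping.keys_add)
  moreover have "subst_mono X a = (\<Prod>v\<in>?A. X v ^ Poly_Mapping.lookup a v)"
    by (rule subst_mono_superset) auto
  moreover have "subst_mono X b = (\<Prod>v\<in>?A. X v ^ Poly_Mapping.lookup b v)"
    by (rule subst_mono_superset) auto
  ultimately show ?thesis
    by (simp add: lookup_add power_add prod.distrib)
qed

definition subst_poly ::
    "('v \<Rightarrow> ('l::comm_monoid_add \<Rightarrow>\<^sub>0 real)) \<Rightarrow> 'v mpoly \<Rightarrow> ('l \<Rightarrow>\<^sub>0 real)" where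
  "subst_poly X = alg_ext (subst_mono X)"

lemma subst_poly_add: "subst_poly X (p + q) = subst_poly X p + subst_poly X q"
  by (simp add: subst_poly_def alg_ext_add)

lemma subst_poly_diff: "subst_poly X (p - q) = subst_poly X p - subst_poly X q"
  by (simp add: subst_poly_def alg_ext_diff)

lemma subst_poly_sum: "subst_poly X (sum p A) = (\<Sum>a\<in>A. subst_poly X (p a))"
  by (simp add: subst_poly_def alg_ext_sum)

lemma subst_poly_mult: "subst_poly X (p * q) = subst_poly X p * subst_poly X q"
  by (simp add: subst_poly_def alg_ext_mult subst_mono_add)

lemma subst_poly_const: "subst_poly X (poly_const c) = Poly_Mapping.single 0 c"
  by (simp add: subst_poly_def poly_const_def subst_mono_def)

lemma subst_poly_var: "subst_poly X (poly_var v) = X v"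
  by (simp add: subst_poly_def poly_var_def subst_mono_def)

lemma poly_const_0 [simp]: "poly_const 0 = 0"
  by (simp add: poly_const_def)

lemma poly_const_1 [simp]: "poly_const 1 = 1"
  by (simp add: poly_const_def)

lemma poly_const_add: "poly_const (a + b) = poly_const a + poly_const b"
  by (simp add: poly_const_def single_add)

lemma poly_const_diff: "poly_const (a - b) = poly_const a - poly_const b"
  by (simp add: poly_const_def single_diff)

lemma poly_const_mult: "poly_const (a * b) = poly_const a * poly_const b"
  by (simp add: poly_const_def mult_single)

lemma poly_const_power: "poly_const (a ^ k) = poly_const a ^ k"
  by (induction k) (simp_all add: poly_const_mult)

lemma poly_const_sum: "poly_const (sum f A) = (\<Sum>a\<in>A. poly_const (f a))"
  by (induction A rule: infinite_finite_induct) (simp_all add: poly_const_add)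

lemma subst_poly_one: "subst_poly X 1 = 1"
  using subst_poly_const[of X 1] by simp

lemma subst_poly_power: "subst_poly X (p ^ k) = subst_poly X p ^ k"
  by (induction k) (simp_all add: subst_poly_mult subst_poly_one)

text \<open>Used in \<open>chain_comb_homogeneous\<close> to build a monomial one variable at a
  time.\<close>

lemma single_eq_const_prod_vars:
  "Poly_Mapping.single m c =
    poly_const c * (\<Prod>v\<in>Poly_Mapping.keys m. poly_var v ^ Poly_Mapping.lookup m v)"
proof -
  have pow: "poly_var v ^ k = Poly_Mapping.single (Poly_Mapping.single v k) 1" for v :: 'a and k
    by (induction k) (simp_all add: poly_var_def mult_single single_add[symmetric])
  have prod: "(\<Prod>v\<in>A. Poly_Mapping.single (g v) 1) = Poly_Mapping.single (sum g A) (1::real)"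
    if "finite A" for A :: "'a set" and g
    using that by (induction A) (simp_all add: mult_single)
  show ?thesis
    using poly_mapping_sum_singles[of m] by (simp add: pow prod poly_const_def mult_single)
qed

section \<open>Rank functions of matroids\<close>

context matroid
begin

lemma indep_finite: "X \<in> Ind \<Longrightarrow> finite X"
  using indep_subset_ground finite_ground finite_subset by blast

lemma finite_rk_set: "finite {card Y |Y. Y \<in> Ind \<and> Y \<subseteq> X}"
proof -
  have "{card Y |Y. Y \<in> Ind \<and> Y \<subseteq> X} \<subseteq> card ` Pow E"
    using indep_subset_ground by auto
  then show ?thesis
    using finite_ground finite_subset by blast
qed

lemma card_le_rk: "Y \<in> Ind \<Longrightarrow> Y \<subseteq> X \<Longrightarrow> card Y \<le> rk X"
  unfolding rk_def by (rule Max_ge[OF finite_rk_set]) auto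

lemma rk_attained: "\<exists>Y\<in>Ind. Y \<subseteq> X \<and> card Y = rk X"
proof -
  have "rk X \<in> {card Y |Y. Y \<in> Ind \<and> Y \<subseteq> X}"
    unfolding rk_def by (rule Max_in[OF finite_rk_set]) (use indep_empty in auto)
  then show ?thesis by auto
qed

lemma rk_mono: "X \<subseteq> Y \<Longrightarrow> rk X \<le> rk Y"
  by (metis card_le_rk order_trans rk_attained)

lemma rk_indep: "X \<in> Ind \<Longrightarrow> rk X = card X"
  by (metis card_le_rk card_mono indep_finite le_antisym order_refl rk_attained)

lemma rk_le_card: "finite X \<Longrightarrow> rk X \<le> card X"
  using rk_attained[of X] card_mono by metis

lemma rk_empty [simp]: "rk {} = 0"
  using rk_le_card[of "{}"] by simp

lemma indep_extend:
  assumes "X \<in> Ind" "X \<subseteq> A"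
  shows "\<exists>B\<in>Ind. X \<subseteq> B \<and> B \<subseteq> A \<and> card B = rk A"
  using assms
proof (induction "rk A - card X" arbitrary: X rule: less_induct)
  case less
  show ?case
  proof (cases "card X = rk A")
    case True
    then show ?thesis using less.prems by blast
  next
    case False
    then have lt: "card X < rk A"
      using card_le_rk[OF less.prems] by simp
    obtain Y where Y: "Y \<in> Ind" "Y \<subseteq> A" "card Y = rk A"
      using rk_attained by blast
    obtain y where y: "y \<in> Y - X" "insert y X \<in> Ind"
      using indep_augment[OF less.prems(1) Y(1)] lt Y by auto
    have "card (insert y X) = Suc (card X)"
      using y less.prems indep_finite by simp
    then have "\<exists>B\<in>Ind. insert y X \<subseteq> B \<and> B \<subseteq> A \<and> card B = rk A"
      using y Y less.prems lt by (intro less.hyps) auto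
    then show ?thesis by blast
  qed
qed

text \<open>A maximum independent subset \<open>I\<close> of the intersection extends to one,
  \<open>J\<close>, of the union. Counting \<open>J \<inter> A\<close> and
  \<open>J \<inter> B\<close> separately counts \<open>I\<close> twice.\<close>

lemma rk_submodular: "rk (A \<union> B) + rk (A \<inter> B) \<le> rk A + rk B"
proof -
  obtain I where I: "I \<in> Ind" "I \<subseteq> A \<inter> B" "card I = rk (A \<inter> B)"
    using rk_attained by blast
  obtain J where J: "J \<in> Ind" "I \<subseteq> J" "J \<subseteq> A \<union> B" "card J = rk (A \<union> B)"
    using indep_extend[OF I(1), of "A \<union> B"] I by blast
  have fin: "finite J" using J indep_finite by blast
  have "card (J \<inter> A) + card (J \<inter> B) = card ((J \<inter> A) \<union> (J \<inter> B)) + card ((J \<inter> A) \<inter> (J \<inter> B))"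
    using fin by (intro card_Un_Int) auto
  moreover have "(J \<inter> A) \<union> (J \<inter> B) = J" using J by blast
  moreover have "card I \<le> card ((J \<inter> A) \<inter> (J \<inter> B))"
    using I J fin by (intro card_mono) auto
  moreover have "card (J \<inter> A) \<le> rk A" "card (J \<inter> B) \<le> rk B"
    using J indep_subset by (auto intro!: card_le_rk)
  ultimately show ?thesis using I J by simp
qed

text \<open>Closure is monotone; the proof is submodularity for \<open>insert e T\<close> and
  \<open>T \<union> U\<close>.\<close>

lemma rk_Un_eq:
  assumes "rk (insert e T) = rk T"
  shows "rk (insert e (T \<union> U)) = rk (T \<union> U)"
proof (rule antisym)
  have "insert e T \<union> (T \<union> U) = insert e (T \<union> U)" by blast
  then have "rk (insert e (T \<union> U)) + rk (insert e T \<inter> (T \<union> U)) \<le> rk T + rk (T \<union> U)"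
    using rk_submodular[of "insert e T" "T \<union> U"] assms by simp
  moreover have "rk T \<le> rk (insert e T \<inter> (T \<union> U))"
    by (rule rk_mono) blast
  ultimately show "rk (insert e (T \<union> U)) \<le> rk (T \<union> U)" by simp
  show "rk (T \<union> U) \<le> rk (insert e (T \<union> U))"
    by (rule rk_mono) blast
qed

lemma flat_subset_eq: "flat F \<Longrightarrow> F \<subseteq> G \<Longrightarrow> G \<subseteq> E \<Longrightarrow> rk G \<le> rk F \<Longrightarrow> F = G"
proof (rule ccontr)
  assume *: "flat F" "F \<subseteq> G" "G \<subseteq> E" "rk G \<le> rk F" "F \<noteq> G"
  then obtain x where x: "x \<in> G - F" by blast
  then have "rk F < rk (insert x F)" using * by (auto simp: flat_def)
  also have "\<dots> \<le> rk G" using x * by (intro rk_mono) auto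
  finally show False using * by simp
qed

lemma proper_flatD:
  assumes "F \<in> proper_flats"
  shows "flat F" "F \<subseteq> E" "F \<noteq> {}" "F \<noteq> E" "rk F < rk E" "finite F"
proof -
  show "flat F" "F \<subseteq> E" "F \<noteq> {}" "F \<noteq> E"
    using assms by (auto simp: proper_flats_def flat_def)
  then show "rk F < rk E" "finite F"
    using flat_subset_eq[of F E] finite_ground finite_subset by (auto simp: not_le[symmetric])
qed

lemma finite_proper_flats: "finite proper_flats"
  by (rule finite_subset[of _ "Pow E"]) (auto simp: proper_flats_def flat_def finite_ground)

text \<open>The witness is the closure of \<open>S\<close>. Adding its elements one at a time never
  raises the rank, by \<open>rk_Un_eq\<close>.\<close>

lemma ex_flat_cover:
  assumes "S \<subseteq> E"
  shows "\<exists>F. flat F \<and> S \<subseteq> F \<and> rk F = rk S \<and> (\<forall>e\<in>E. rk (insert e S) = rk S \<longrightarrow> e \<in> F)"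
proof -
  define F where "F = {e\<in>E. rk (insert e S) = rk S}"
  have SF: "S \<subseteq> F" using assms by (auto simp: F_def insert_absorb)
  have "finite F" using finite_ground by (auto simp: F_def)
  have "rk (S \<union> A) = rk S" if "finite A" "A \<subseteq> F" for A
    using that
  proof (induction A)
    case (insert a A)
    then have "rk (insert a (S \<union> A)) = rk (S \<union> A)"
      by (intro rk_Un_eq) (auto simp: F_def)
    then show ?case using insert by simp
  qed simp
  from this[OF \<open>finite F\<close> subset_refl] have rkF: "rk F = rk S"
    using SF by (simp add: Un_absorb1)
  moreover have "flat F"
    unfolding flat_def
  proof (intro conjI ballI)
    show "F \<subseteq> E" by (auto simp: F_def)
    fix x assume x: "x \<in> E - F"
    have "rk S \<le> rk (insert x S)" by (rule rk_mono) auto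
    then have "rk S < rk (insert x S)" using x by (auto simp: F_def)
    also have "\<dots> \<le> rk (insert x F)" using SF by (intro rk_mono) auto
    finally show "rk F < rk (insert x F)" using rkF by simp
  qed
  ultimately show ?thesis using SF by (auto simp: F_def)
qed

lemma flat_ground: "flat E"
  by (simp add: flat_def)

end

section \<open>The dragon Hall-Rado functional\<close>

text \<open>Inserting \<open>a\<close> pairs subsets of opposite sign. The ring is general because
  the signs are later taken in the algebra of the \<open>h_gen\<close>.\<close>

lemma sum_Pow_alternating:
  assumes "finite A"
  shows "(\<Sum>Y\<in>Pow A. (- 1) ^ card Y) = (if A = {} then 1 else (0::'r::comm_ring_1))"
  using assms
proof (induction A)
  case (insert a A)
  have "(\<Sum>Y\<in>Pow (insert a A). (- 1) ^ card Y) =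
      (\<Sum>Y\<in>Pow A. (- 1) ^ card Y) + (\<Sum>Y\<in>insert a ` Pow A. (- 1::'r) ^ card Y)"
    unfolding Pow_insert using insert by (intro sum.union_disjoint) auto
  also have "(\<Sum>Y\<in>insert a ` Pow A. (- 1::'r) ^ card Y) = (\<Sum>Y\<in>Pow A. (- 1) ^ card (insert a Y))"
    using insert by (subst sum.reindex) (auto simp: inj_on_def)
  also have "\<dots> = (\<Sum>Y\<in>Pow A. - ((- 1) ^ card Y))"
    using insert by (intro sum.cong) (auto simp: finite_subset card_insert_if)
  finally show ?case by (simp add: sum_negf)
qed simp

lemma lin_ext_scale: "lin_ext f (Poly_Mapping.single 0 c * p) = c * lin_ext f p"
proof -
  have "lin_ext f (Poly_Mapping.single 0 c * p) = lin_ext f (Poly_Mapping.single 0 c *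
      (\<Sum>k\<in>Poly_Mapping.keys p. Poly_Mapping.single k (Poly_Mapping.lookup p k)))"
    using poly_mapping_sum_singles[of p] by simp
  also have "\<dots> = c * lin_ext f p"
    by (simp add: sum_distrib_left mult_single lin_ext_sum) (simp add: lin_ext_def sum_distrib_left mult.assoc)
  finally show ?thesis .
qed

lemma subset_imp_subset_add_mset: "N \<subseteq># M \<Longrightarrow> N \<subseteq># add_mset T M"
  by (metis add_mset_add_single mset_subset_eq_add_left subset_mset.order_trans)

lemma subset_add_mset_cases:
  assumes "N \<subseteq># add_mset T M"
  obtains "N \<subseteq># M" | N' where "N = add_mset T N'" "N' \<subseteq># M"
proof (cases "T \<in># N")
  case True
  then obtain N' where "N = add_mset T N'" by (metis insert_DiffM)
  then show ?thesis using assms that(2) by simp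
next
  case False
  have "count N x \<le> count M x" for x
    using mset_subset_eq_count[OF assms, of x] False
    by (cases "x = T") (auto simp: not_in_iff)
  then have "N \<subseteq># M" by (simp add: subseteq_mset_def)
  then show ?thesis using that(1) by blast
qed

context matroid
begin

text \<open>Multisets are used because generators may repeat in a product; subfamilies are counted
  with repetition, so that powers of one generator are constrained too.\<close>

definition dragon :: "'a set multiset \<Rightarrow> bool" where
  "dragon M \<longleftrightarrow> (\<forall>N. N \<subseteq># M \<longrightarrow> N \<noteq> {#} \<longrightarrow> size N < rk (\<Union>(set_mset N)))"

lemma dragonD: "dragon M \<Longrightarrow> N \<subseteq># M \<Longrightarrow> N \<noteq> {#} \<Longrightarrow> size N < rk (\<Union>(set_mset N))"
  by (simp add: dragon_def)

text \<open>Submultisets are split by whether they use the new copy of \<open>T\<close>. The empty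
  \<open>N\<close> contributes \<open>1 < rk T\<close>.\<close>

lemma dragon_add_mset:
  "dragon (add_mset T M) \<longleftrightarrow>
    dragon M \<and> (\<forall>N. N \<subseteq># M \<longrightarrow> Suc (size N) < rk (T \<union> \<Union>(set_mset N)))"
proof (intro iffI conjI allI impI)
  assume *: "dragon (add_mset T M)"
  show "dragon M"
    unfolding dragon_def
  proof (intro allI impI)
    fix N assume "N \<subseteq># M" "N \<noteq> {#}"
    then show "size N < rk (\<Union>(set_mset N))"
      by (intro dragonD[OF *] subset_imp_subset_add_mset)
  qed
  fix N assume N: "N \<subseteq># M"
  have "add_mset T N \<subseteq># add_mset T M" using N by simp
  then have "size (add_mset T N) < rk (\<Union>(set_mset (add_mset T N)))"
    by (intro dragonD[OF *]) simp_all
  then show "Suc (size N) < rk (T \<union> \<Union>(set_mset N))" by simp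
next
  assume *: "dragon M \<and> (\<forall>N. N \<subseteq># M \<longrightarrow> Suc (size N) < rk (T \<union> \<Union>(set_mset N)))"
  show "dragon (add_mset T M)"
    unfolding dragon_def
  proof (intro allI impI)
    fix N assume "N \<subseteq># add_mset T M" "N \<noteq> {#}"
    then show "size N < rk (\<Union>(set_mset N))"
      using * by (elim subset_add_mset_cases) (auto simp: dragon_def)
  qed
qed

section \<open>The functional and its null ideal\<close>

definition dragon_weight :: "'a set multiset \<Rightarrow> real" where
  "dragon_weight M = of_bool (size M = rk E - 1 \<and> dragon M)"

text \<open>Quantifying over all multipliers gives the largest ideal on which the functional
  vanishes.\<close>

definition dragon_null :: "('a set multiset \<Rightarrow>\<^sub>0 real) \<Rightarrow> bool" where
  "dragon_null p \<longleftrightarrow> (\<forall>q. lin_ext dragon_weight (q * p) = 0)"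

lemma dragon_null_0 [simp]: "dragon_null 0"
  by (simp add: dragon_null_def)

lemma dragon_null_add: "dragon_null p \<Longrightarrow> dragon_null q \<Longrightarrow> dragon_null (p + q)"
  by (simp add: dragon_null_def distrib_left lin_ext_add)

lemma dragon_null_diff: "dragon_null p \<Longrightarrow> dragon_null q \<Longrightarrow> dragon_null (p - q)"
  by (simp add: dragon_null_def right_diff_distrib lin_ext_diff)

lemma dragon_null_mult: "dragon_null p \<Longrightarrow> dragon_null (q * p)"
  by (simp add: dragon_null_def mult.assoc[symmetric])

lemma dragon_null_uminus: "dragon_null p \<Longrightarrow> dragon_null (- p)"
  using dragon_null_diff[of 0 p] by simp

lemma dragon_null_sum: "(\<And>a. a \<in> A \<Longrightarrow> dragon_null (p a)) \<Longrightarrow> dragon_null (sum p A)"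
  by (induction A rule: infinite_finite_induct) (auto intro: dragon_null_add)

lemma dragon_nullI:
  assumes "\<And>M. lin_ext dragon_weight (Poly_Mapping.single M 1 * p) = 0"
  shows "dragon_null p"
  unfolding dragon_null_def
proof
  fix q
  have "lin_ext dragon_weight (Poly_Mapping.single M c * p) = 0" for M c
  proof -
    have "Poly_Mapping.single M c * p = Poly_Mapping.single 0 c * (Poly_Mapping.single M 1 * p)"
      by (simp add: mult.assoc[symmetric] mult_single)
    then show ?thesis using assms by (simp add: lin_ext_scale)
  qed
  then have "lin_ext dragon_weight
      ((\<Sum>k\<in>Poly_Mapping.keys q. Poly_Mapping.single k (Poly_Mapping.lookup q k)) * p) = 0"
    by (simp add: sum_distrib_right lin_ext_sum)
  then show "lin_ext dragon_weight (q * p) = 0"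
    using poly_mapping_sum_singles[of q] by simp
qed

section \<open>The generators h and x\<close>

definition h_gen :: "'a set \<Rightarrow> ('a set multiset \<Rightarrow>\<^sub>0 real)" where
  "h_gen T = Poly_Mapping.single {#T#} 1"

lemma single_mult_h_gen:
  "Poly_Mapping.single M 1 * h_gen T = Poly_Mapping.single (add_mset T M) 1"
  by (simp add: h_gen_def mult_single)

text \<open>The inverse of \<open>h\<^sub>T = - (\<Sum>S\<supseteq>T. x\<^sub>S)\<close>, by Moebius inversion on the Boolean lattice. The
  sums over all subsets \<open>S\<close> agree with those over flats, since \<open>x\<^sub>S\<close> acts as zero if \<open>S\<close> is not flat.\<close>

definition x_img :: "'a set \<Rightarrow> ('a set multiset \<Rightarrow>\<^sub>0 real)" where
  "x_img S = - (\<Sum>T\<in>{T. S \<subseteq> T \<and> T \<subseteq> E}. (- 1) ^ card (T - S) * h_gen T)"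

lemma finite_between: "finite {T. S \<subseteq> T \<and> T \<subseteq> E}"
  by (rule finite_subset[of _ "Pow E"]) (auto simp: finite_ground)

text \<open>Pairing \<open>T\<close> with \<open>insert e T\<close> gives opposite signs. With
  \<open>e\<close> chosen suitably, the resulting differences, or products of two of them, are
  null.\<close>

lemma x_img_toggle:
  assumes "e \<in> E - S"
  shows "x_img S = - (\<Sum>T\<in>{T. S \<subseteq> T \<and> T \<subseteq> E \<and> e \<notin> T}.
    (- 1) ^ card (T - S) * (h_gen T - h_gen (insert e T)))"
proof -
  let ?A = "{T. S \<subseteq> T \<and> T \<subseteq> E \<and> e \<notin> T}"
  have finA: "finite ?A"
    by (rule finite_subset[OF _ finite_between[of S]]) auto
  have "T \<in> ?A \<union> insert e ` ?A" if "S \<subseteq> T" "T \<subseteq> E" for T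
  proof (cases "e \<in> T")
    case True
    then have "T = insert e (T - {e})" "T - {e} \<in> ?A" using that assms by auto
    then show ?thesis by blast
  qed (use that in auto)
  then have split: "{T. S \<subseteq> T \<and> T \<subseteq> E} = ?A \<union> insert e ` ?A"
    using assms by auto
  have "(\<Sum>T\<in>insert e ` ?A. (- 1) ^ card (T - S) * h_gen T) =
      (\<Sum>T\<in>?A. (- 1) ^ card (insert e T - S) * h_gen (insert e T))"
    by (subst sum.reindex) (auto simp: inj_on_def)
  also have "\<dots> = (\<Sum>T\<in>?A. - ((- 1) ^ card (T - S)) * h_gen (insert e T))"
  proof (rule sum.cong)
    fix T assume T: "T \<in> ?A"
    then have "finite T" using finite_ground finite_subset by auto
    moreover have "insert e T - S = insert e (T - S)" using assms by auto
    ultimately show "(- 1) ^ card (insert e T - S) * h_gen (insert e T) =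
        - ((- 1) ^ card (T - S)) * h_gen (insert e T)"
      using T by simp
  qed simp
  finally have "(\<Sum>T\<in>{T. S \<subseteq> T \<and> T \<subseteq> E}. (- 1) ^ card (T - S) * h_gen T) =
      (\<Sum>T\<in>?A. (- 1) ^ card (T - S) * h_gen T) +
      (\<Sum>T\<in>?A. - ((- 1) ^ card (T - S)) * h_gen (insert e T))"
    unfolding split using finA by (subst sum.union_disjoint) auto
  then show ?thesis
    by (simp add: x_img_def sum.distrib[symmetric] algebra_simps)
qed

text \<open>Moebius inversion: after exchanging the sums, the signs over the interval from
  \<open>R\<close> to \<open>T\<close> cancel unless \<open>T = R\<close>.\<close>

lemma sum_x_img_supersets:
  assumes "R \<subseteq> E"
  shows "(\<Sum>S\<in>{S. R \<subseteq> S \<and> S \<subseteq> E}. x_img S) = - h_gen R"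
proof -
  let ?B = "{S. R \<subseteq> S \<and> S \<subseteq> E}"
  have inner: "(\<Sum>S\<in>{S. S \<in> ?B \<and> S \<subseteq> T}. (- 1) ^ card (T - S) * h_gen T) =
      (if T = R then h_gen R else 0)" if T: "T \<in> ?B" for T
  proof -
    have fin: "finite (T - R)" using T finite_ground finite_subset by blast
    \<comment> \<open>Complementation in \<open>T\<close> turns the interval from \<open>R\<close>
      to \<open>T\<close> into the power set of \<open>T - R\<close>.\<close>
    have "bij_betw (\<lambda>S. T - S) {S. S \<in> ?B \<and> S \<subseteq> T} (Pow (T - R))"
      by (rule bij_betw_byWitness[where f' = "\<lambda>Y. T - Y"]) (use T in auto)
    then have "(\<Sum>S\<in>{S. S \<in> ?B \<and> S \<subseteq> T}. (- 1) ^ card (T - S)) =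
        (\<Sum>Y\<in>Pow (T - R). (- 1 :: 'a set multiset \<Rightarrow>\<^sub>0 real) ^ card Y)"
      by (rule sum.reindex_bij_betw)
    also have "\<dots> = (if T = R then 1 else 0)"
      using T by (subst sum_Pow_alternating[OF fin]) auto
    finally show ?thesis by (simp add: sum_distrib_right[symmetric])
  qed
  have "(\<Sum>S\<in>?B. \<Sum>T\<in>{T. T \<in> ?B \<and> S \<subseteq> T}. (- 1) ^ card (T - S) * h_gen T) =
      (\<Sum>T\<in>?B. \<Sum>S\<in>{S. S \<in> ?B \<and> S \<subseteq> T}. (- 1) ^ card (T - S) * h_gen T)"
    by (rule sum.swap_restrict) (rule finite_between)+
  also have "\<dots> = h_gen R"
    using assms by (subst sum.cong[OF refl inner]) (auto simp: finite_between)
  finally have "(\<Sum>S\<in>?B. \<Sum>T\<in>{T. T \<in> ?B \<and> S \<subseteq> T}. (- 1) ^ card (T - S) * h_gen T) = h_gen R" .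
  moreover have "x_img S = - (\<Sum>T\<in>{T. T \<in> ?B \<and> S \<subseteq> T}. (- 1) ^ card (T - S) * h_gen T)"
    if "S \<in> ?B" for S
  proof -
    have "{T. T \<in> ?B \<and> S \<subseteq> T} = {T. S \<subseteq> T \<and> T \<subseteq> E}" using that by auto
    then show ?thesis by (simp only: x_img_def)
  qed
  ultimately show ?thesis
    by (subst sum.cong[OF refl, of ?B x_img]) (auto simp: sum_negf)
qed

text \<open>Take \<open>e\<close> in the closure of \<open>S\<close> but not in \<open>S\<close>.
  Every \<open>T\<close> in the expansion contains \<open>S\<close>, so replacing \<open>T\<close>
  by \<open>insert e T\<close> changes no rank in the dragon condition, and all differences are
  null.\<close>

lemma x_img_nonflat_null:
  assumes "S \<subseteq> E" "\<not> flat S"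
  shows "dragon_null (x_img S)"
proof -
  obtain e where e: "e \<in> E - S" "rk (insert e S) \<le> rk S"
    using assms by (auto simp: flat_def not_less)
  then have eq: "rk (insert e S) = rk S"
    using rk_mono[OF subset_insertI[of S e]] by simp
  have "dragon_null (h_gen T - h_gen (insert e T))" if "S \<subseteq> T" for T
  proof (rule dragon_nullI)
    fix M
    have "rk (insert e (T \<union> U)) = rk (T \<union> U)" for U
      using rk_Un_eq[OF eq, of "T \<union> U"] that by (simp add: Un_absorb1 Un_assoc[symmetric])
    then have "dragon (add_mset (insert e T) M) = dragon (add_mset T M)"
      by (simp add: dragon_add_mset)
    then show "lin_ext dragon_weight (Poly_Mapping.single M 1 * (h_gen T - h_gen (insert e T))) = 0"
      by (simp add: right_diff_distrib single_mult_h_gen lin_ext_diff dragon_weight_def)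
  qed
  then show ?thesis
    unfolding x_img_toggle[OF e(1)]
    by (intro dragon_null_uminus dragon_null_sum dragon_null_mult) auto
qed

text \<open>The subfamily consisting of \<open>{i}\<close> alone violates the dragon condition,
  because a singleton has rank at most 1.\<close>

lemma h_gen_singleton_null: "dragon_null (h_gen {i})"
proof (rule dragon_nullI)
  fix M
  have "\<not> dragon (add_mset {i} M)"
  proof
    assume "dragon (add_mset {i} M)"
    then have "\<forall>N. N \<subseteq># M \<longrightarrow> Suc (size N) < rk ({i} \<union> \<Union>(set_mset N))"
      by (simp add: dragon_add_mset)
    from this[rule_format, of "{#}"] have "1 < rk {i}" by simp
    then show False using rk_le_card[of "{i}"] by simp
  qed
  then show "lin_ext dragon_weight (Poly_Mapping.single M 1 * h_gen {i}) = 0"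
    by (simp add: single_mult_h_gen dragon_weight_def)
qed

text \<open>Apart from the common size condition, the weight is a product of a condition on
  \<open>M\<close>, one on each of the two sets, and a joint one on their union. The hypotheses keep
  the union fixed, so the second difference factors into two first differences. A first difference
  vanishes once its smaller set meets its condition, by monotonicity; submodularity shows that one
  of the two sets does so whenever the remaining factors are nonzero.\<close>

lemma dragon_second_difference:
  assumes "a \<in> T'" "b \<in> T"
  shows "dragon_weight (add_mset T (add_mset T' M)) - dragon_weight (add_mset (insert a T) (add_mset T' M))
    - dragon_weight (add_mset T (add_mset (insert b T') M))
    + dragon_weight (add_mset (insert a T) (add_mset (insert b T') M)) = 0"
proof -
  \<comment> \<open>\<open>W\<close> handles the subfamilies that use one of the two new sets,
    \<open>J\<close> those that use both; \<open>J\<close> sees only the union of the two.\<close>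
  define W where "W T \<longleftrightarrow> (\<forall>N. N \<subseteq># M \<longrightarrow> Suc (size N) < rk (T \<union> \<Union>(set_mset N)))" for T
  define J where "J U \<longleftrightarrow> (\<forall>N. N \<subseteq># M \<longrightarrow> Suc (Suc (size N)) < rk (U \<union> \<Union>(set_mset N)))" for U
  have eq: "dragon (add_mset T (add_mset T' M)) \<longleftrightarrow> dragon M \<and> W T \<and> W T' \<and> J (T \<union> T')" for T T'
  proof -
    have "(\<forall>N. N \<subseteq># add_mset T' M \<longrightarrow> Suc (size N) < rk (T \<union> \<Union>(set_mset N))) \<longleftrightarrow> W T \<and> J (T \<union> T')"
    proof (intro iffI conjI allI impI)
      assume *: "\<forall>N. N \<subseteq># add_mset T' M \<longrightarrow> Suc (size N) < rk (T \<union> \<Union>(set_mset N))"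
      show "W T"
        unfolding W_def using * by (simp add: subset_imp_subset_add_mset)
      show "J (T \<union> T')"
        unfolding J_def
      proof (intro allI impI)
        fix N assume "N \<subseteq># M"
        then have "add_mset T' N \<subseteq># add_mset T' M" by simp
        from *[rule_format, OF this]
        have "Suc (size (add_mset T' N)) < rk (T \<union> \<Union>(set_mset (add_mset T' N)))" .
        then show "Suc (Suc (size N)) < rk (T \<union> T' \<union> \<Union>(set_mset N))" by (simp add: Un_assoc)
      qed
    next
      fix N assume "W T \<and> J (T \<union> T')" "N \<subseteq># add_mset T' M"
      then show "Suc (size N) < rk (T \<union> \<Union>(set_mset N))"
        by (elim subset_add_mset_cases) (auto simp: W_def J_def Un_assoc)
    qed
    then show ?thesis
      unfolding dragon_add_mset[of T] dragon_add_mset[of T'] W_def[of T'] by auto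
  qed
  have unions: "insert a T \<union> T' = T \<union> T'" "T \<union> insert b T' = T \<union> T'"
    "insert a T \<union> insert b T' = T \<union> T'"
    using assms by auto
  have mono: "W X \<Longrightarrow> X \<subseteq> Y \<Longrightarrow> W Y" for X Y
    unfolding W_def by (meson Un_mono less_le_trans order_refl rk_mono)
  \<comment> \<open>If both failed, with witnesses \<open>N1\<close> and \<open>N2\<close>,
    submodularity would bound the ranks of the union and the intersection of the two violating
    unions by a total of \<open>size N1 + size N2 + 2\<close>. The joint condition for
    \<open>N1 \<union># N2\<close> and \<open>dragon M\<close> for \<open>N1 \<inter># N2\<close>
    force more.\<close>
  have "W T \<or> W T'" if dM: "dragon M" and J: "J (T \<union> T')"
  proof (rule ccontr)
    assume "\<not> (W T \<or> W T')"
    then obtain N1 N2 where N: "N1 \<subseteq># M" "rk (T \<union> \<Union>(set_mset N1)) \<le> Suc (size N1)"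
      "N2 \<subseteq># M" "rk (T' \<union> \<Union>(set_mset N2)) \<le> Suc (size N2)"
      by (auto simp: W_def not_less)
    have "size (N1 \<union># N2) + size (N1 \<inter># N2) = size N1 + size N2"
    proof -
      have "(N1 \<union># N2) + (N1 \<inter># N2) = N1 + N2"
        by (rule multiset_eqI) auto
      then show ?thesis by (metis size_union)
    qed
    moreover have "Suc (Suc (size (N1 \<union># N2))) < rk (T \<union> T' \<union> \<Union>(set_mset (N1 \<union># N2)))"
      using J N unfolding J_def by (meson subset_mset.sup_least)
    moreover have "T \<union> T' \<union> \<Union>(set_mset (N1 \<union># N2)) =
        (T \<union> \<Union>(set_mset N1)) \<union> (T' \<union> \<Union>(set_mset N2))"
      by auto
    moreover have "rk (\<Union>(set_mset (N1 \<inter># N2))) \<le>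
        rk ((T \<union> \<Union>(set_mset N1)) \<inter> (T' \<union> \<Union>(set_mset N2)))"
      by (rule rk_mono) auto
    moreover have "size (N1 \<inter># N2) \<le> rk (\<Union>(set_mset (N1 \<inter># N2)))"
    proof (cases "N1 \<inter># N2 = {#}")
      case False
      have "N1 \<inter># N2 \<subseteq># M" using N subset_mset.le_infI1 by blast
      then show ?thesis using dragonD[OF dM _ False] by (simp add: less_imp_le)
    qed simp
    ultimately show False
      using N rk_submodular[of "T \<union> \<Union>(set_mset N1)" "T' \<union> \<Union>(set_mset N2)"] by simp
  qed
  then show ?thesis
    using mono[of T "insert a T"] mono[of T' "insert b T'"]
    unfolding dragon_weight_def eq unions by auto
qed

text \<open>With \<open>a\<close> in \<open>S' - S\<close> and \<open>b\<close> in
  \<open>S - S'\<close>, toggle \<open>a\<close> in the first factor and \<open>b\<close> in the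
  second. Every pair \<open>T\<close>, \<open>T'\<close> satisfies \<open>a \<in> T'\<close> and
  \<open>b \<in> T\<close>, so each product of differences is a vanishing second difference.\<close>

lemma x_img_incomparable_null:
  assumes "S \<subseteq> E" "S' \<subseteq> E" "\<not> S \<subseteq> S'" "\<not> S' \<subseteq> S"
  shows "dragon_null (x_img S * x_img S')"
proof -
  obtain a b where ab: "a \<in> S'" "a \<notin> S" "b \<in> S" "b \<notin> S'" using assms by blast
  have "dragon_null ((h_gen T - h_gen (insert a T)) * (h_gen T' - h_gen (insert b T')))"
    if "S \<subseteq> T" "S' \<subseteq> T'" for T T'
  proof (rule dragon_nullI)
    fix M
    have hh: "Poly_Mapping.single M 1 * (h_gen A * h_gen B) =
        Poly_Mapping.single (add_mset A (add_mset B M)) 1" for A B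
      by (simp add: h_gen_def mult_single add_mset_commute)
    have "Poly_Mapping.single M 1 * ((h_gen T - h_gen (insert a T)) * (h_gen T' - h_gen (insert b T')))
      = Poly_Mapping.single M 1 * (h_gen T * h_gen T')
       - Poly_Mapping.single M 1 * (h_gen (insert a T) * h_gen T')
       - Poly_Mapping.single M 1 * (h_gen T * h_gen (insert b T'))
       + Poly_Mapping.single M 1 * (h_gen (insert a T) * h_gen (insert b T'))"
      by (simp only: algebra_simps)
    then show "lin_ext dragon_weight (Poly_Mapping.single M 1 *
        ((h_gen T - h_gen (insert a T)) * (h_gen T' - h_gen (insert b T')))) = 0"
      using dragon_second_difference[of a T' b T M] that ab
      by (simp add: hh lin_ext_diff lin_ext_add subset_iff)
  qed
  note null = this
  have "x_img S * x_img S' =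
    (\<Sum>T\<in>{T. S \<subseteq> T \<and> T \<subseteq> E \<and> a \<notin> T}. \<Sum>T'\<in>{T. S' \<subseteq> T \<and> T \<subseteq> E \<and> b \<notin> T}.
      ((- 1) ^ card (T - S) * (- 1) ^ card (T' - S')) *
      ((h_gen T - h_gen (insert a T)) * (h_gen T' - h_gen (insert b T'))))"
    using ab assms x_img_toggle[of a S] x_img_toggle[of b S']
    by (simp add: subset_iff sum_product mult.assoc mult.left_commute)
  also have "dragon_null \<dots>"
    by (intro dragon_null_sum dragon_null_mult null) auto
  finally show ?thesis .
qed

text \<open>In \<open>sum_x_img_supersets\<close> the term of \<open>E\<close> is
  \<open>- h_gen E\<close> and the non-flats are null; the empty set does not occur since
  \<open>R\<close> is nonempty.\<close>

lemma sum_proper_flats_null: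
  assumes "R \<subseteq> E" "R \<noteq> {}"
  shows "dragon_null ((\<Sum>F\<in>{F\<in>proper_flats. R \<subseteq> F}. x_img F) - (h_gen E - h_gen R))"
proof -
  let ?N = "{S. R \<subseteq> S \<and> S \<subseteq> E \<and> \<not> flat S}"
  have "{S. R \<subseteq> S \<and> S \<subseteq> E} = insert E ({F\<in>proper_flats. R \<subseteq> F} \<union> ?N)"
    using assms by (auto simp: proper_flats_def flat_def)
  moreover have "E \<notin> {F\<in>proper_flats. R \<subseteq> F} \<union> ?N"
    using flat_ground by (auto simp: proper_flats_def)
  moreover have "finite ({F\<in>proper_flats. R \<subseteq> F} \<union> ?N)"
    by (rule finite_subset[OF _ finite_between[of R]]) (auto simp: proper_flats_def flat_def)
  moreover have "(\<Sum>F\<in>{F\<in>proper_flats. R \<subseteq> F} \<union> ?N. x_img F) =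
      (\<Sum>F\<in>{F\<in>proper_flats. R \<subseteq> F}. x_img F) + (\<Sum>F\<in>?N. x_img F)"
    using finite_proper_flats finite_subset[OF _ finite_between[of R], of ?N]
    by (intro sum.union_disjoint) (auto simp: proper_flats_def)
  ultimately have "- h_gen R = x_img E +
      ((\<Sum>F\<in>{F\<in>proper_flats. R \<subseteq> F}. x_img F) + (\<Sum>F\<in>?N. x_img F))"
    using sum_x_img_supersets[OF assms(1)] by simp
  moreover have "x_img E = - h_gen E"
  proof -
    have "{S. E \<subseteq> S \<and> S \<subseteq> E} = {E}" by auto
    then show ?thesis using sum_x_img_supersets[of E] by simp
  qed
  ultimately have "(\<Sum>F\<in>{F\<in>proper_flats. R \<subseteq> F}. x_img F) - (h_gen E - h_gen R) =
      - (\<Sum>F\<in>?N. x_img F)"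
    by (simp add: algebra_simps)
  moreover have "dragon_null (- (\<Sum>F\<in>?N. x_img F))"
    by (intro dragon_null_uminus dragon_null_sum x_img_nonflat_null) auto
  ultimately show ?thesis by (simp only:)
qed

section \<open>The degree functional on polynomials\<close>

definition deg_poly :: "'a set mpoly \<Rightarrow> real" where
  "deg_poly p = lin_ext dragon_weight (subst_poly x_img p)"

lemma deg_poly_add: "deg_poly (p + q) = deg_poly p + deg_poly q"
  by (simp add: deg_poly_def subst_poly_add lin_ext_add)

lemma deg_poly_diff: "deg_poly (p - q) = deg_poly p - deg_poly q"
  by (simp add: deg_poly_def subst_poly_diff lin_ext_diff)

lemma deg_poly_scale: "deg_poly (poly_const c * p) = c * deg_poly p"
  by (simp add: deg_poly_def subst_poly_mult subst_poly_const lin_ext_scale)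

lemma dragon_null_power:
  assumes "dragon_null (p - q)"
  shows "dragon_null (p ^ k - q ^ k)"
  using dragon_null_mult[OF assms, of "\<Sum>i<k. p ^ i * q ^ (k - Suc i)"]
  by (simp add: power_diff_sumr2 mult.commute)

lemma lin_ext_eq_if_null:
  assumes "dragon_null (p - q)"
  shows "lin_ext dragon_weight p = lin_ext dragon_weight q"
proof -
  have "lin_ext dragon_weight (1 * (p - q)) = 0"
    using assms unfolding dragon_null_def by blast
  then show ?thesis by (simp add: lin_ext_diff)
qed

lemma h_gen_power: "h_gen T ^ k = Poly_Mapping.single (replicate_mset k T) 1"
  by (induction k) (simp_all add: h_gen_def mult_single)

text \<open>A representative of the hyperplane class: all \<open>i\<close> in \<open>E\<close> agree
  modulo the linear relations, and the image is \<open>h_gen E\<close> up to null elements.\<close>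

definition alpha :: "'a \<Rightarrow> 'a set mpoly" where
  "alpha i = (\<Sum>F\<in>{F\<in>proper_flats. i \<in> F}. poly_var F)"

lemma subst_alpha_null:
  assumes "i \<in> E"
  shows "dragon_null (subst_poly x_img (alpha i) - h_gen E)"
proof -
  have "subst_poly x_img (alpha i) = (\<Sum>F\<in>{F\<in>proper_flats. {i} \<subseteq> F}. x_img F)"
    by (simp add: alpha_def subst_poly_sum subst_poly_var)
  then have eq: "subst_poly x_img (alpha i) - h_gen E =
      ((\<Sum>F\<in>{F\<in>proper_flats. {i} \<subseteq> F}. x_img F) - (h_gen E - h_gen {i})) - h_gen {i}"
    by simp
  show ?thesis
    unfolding eq using assms
    by (intro dragon_null_diff sum_proper_flats_null h_gen_singleton_null) auto
qed

text \<open>Every nonempty subfamily of \<open>rk E - 1\<close> copies of \<open>E\<close> has union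
  \<open>E\<close>, so the dragon condition holds.\<close>

lemma deg_poly_alpha_power:
  assumes "i \<in> E"
  shows "deg_poly (alpha i ^ (rk E - 1)) = 1"
proof -
  let ?d = "rk E - 1"
  have "dragon (replicate_mset ?d E)"
    unfolding dragon_def
  proof (intro allI impI)
    fix N assume N: "N \<subseteq># replicate_mset ?d E" "N \<noteq> {#}"
    then have "set_mset N \<subseteq> {E}"
      using set_mset_mono[OF N(1)] by (auto split: if_splits)
    then have "set_mset N = {E}" using N(2) by (simp add: subset_singleton_iff)
    moreover have "size N \<le> ?d" using size_mset_mono[OF N(1)] by simp
    moreover have "size N > 0" using N(2) by (simp add: nonempty_has_size)
    ultimately show "size N < rk (\<Union>(set_mset N))" by simp
  qed
  then have "lin_ext dragon_weight (h_gen E ^ ?d) = 1"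
    by (simp add: h_gen_power dragon_weight_def)
  moreover have "deg_poly (alpha i ^ ?d) = lin_ext dragon_weight (h_gen E ^ ?d)"
    unfolding deg_poly_def subst_poly_power
    by (intro lin_ext_eq_if_null dragon_null_power subst_alpha_null assms)
  ultimately show ?thesis by simp
qed

text \<open>For \<open>i \<in> C\<close> and \<open>C \<subseteq> E\<close>, a representative of
  \<open>h_gen C\<close> with nonnegative coefficients.\<close>

definition eta :: "'a set \<Rightarrow> 'a \<Rightarrow> 'a set mpoly" where
  "eta C i = (\<Sum>F\<in>{F\<in>proper_flats. i \<in> F \<and> \<not> C \<subseteq> F}. poly_var F)"

lemma alpha_eq_eta:
  assumes "i \<in> C"
  shows "alpha i = eta C i + (\<Sum>F\<in>{F\<in>proper_flats. C \<subseteq> F}. poly_var F)"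
proof -
  have "{F\<in>proper_flats. i \<in> F} = {F\<in>proper_flats. i \<in> F \<and> \<not> C \<subseteq> F} \<union> {F\<in>proper_flats. C \<subseteq> F}"
    using assms by auto
  then have "alpha i = sum poly_var ({F\<in>proper_flats. i \<in> F \<and> \<not> C \<subseteq> F} \<union> {F\<in>proper_flats. C \<subseteq> F})"
    by (simp only: alpha_def)
  also have "\<dots> = eta C i + (\<Sum>F\<in>{F\<in>proper_flats. C \<subseteq> F}. poly_var F)"
    unfolding eta_def by (rule sum.union_disjoint) (auto intro: finite_subset[OF _ finite_proper_flats])
  finally show ?thesis .
qed

lemma subst_eta_null:
  assumes "i \<in> C" "C \<subseteq> E"
  shows "dragon_null (subst_poly x_img (eta C i) - h_gen C)"
proof -
  have "subst_poly x_img (eta C i) = subst_poly x_img (alpha i) - (\<Sum>F\<in>{F\<in>proper_flats. C \<subseteq> F}. x_img F)"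
    using alpha_eq_eta[OF assms(1)] by (simp add: subst_poly_add subst_poly_sum subst_poly_var)
  then have eq: "subst_poly x_img (eta C i) - h_gen C = (subst_poly x_img (alpha i) - h_gen E) -
      ((\<Sum>F\<in>{F\<in>proper_flats. C \<subseteq> F}. x_img F) - (h_gen E - h_gen C))"
    by simp
  show ?thesis
    unfolding eq using assms
    by (intro dragon_null_diff sum_proper_flats_null subst_alpha_null) auto
qed

text \<open>The binomial expansion has terms of weight 0 or 1. Strictness comes from the pure power
  of \<open>h_gen C\<close>, whose \<open>rk E - 1\<close> factors have a union of rank only
  \<open>rk C\<close>.\<close>

lemma deg_poly_alpha_eta_power_less:
  fixes c :: real
  assumes C: "i \<in> C" "C \<subseteq> E" "rk C < rk E" "rk C \<ge> 1" and j: "j \<in> E" and c: "c \<ge> 0"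
  shows "deg_poly ((poly_const c * alpha j + eta C i) ^ (rk E - 1)) < (c + 1) ^ (rk E - 1)"
proof -
  let ?d = "rk E - 1"
  let ?p = "Poly_Mapping.single 0 c * h_gen E + h_gen C"
  define w where "w k = dragon_weight (replicate_mset k E + replicate_mset (?d - k) C)" for k
  have "dragon_null ((subst_poly x_img (poly_const c * alpha j + eta C i)) - ?p)"
  proof -
    have eq: "subst_poly x_img (poly_const c * alpha j + eta C i) - ?p =
        Poly_Mapping.single 0 c * (subst_poly x_img (alpha j) - h_gen E) +
        (subst_poly x_img (eta C i) - h_gen C)"
      by (simp add: subst_poly_add subst_poly_mult subst_poly_const algebra_simps)
    show ?thesis
      unfolding eq using C j
      by (intro dragon_null_add dragon_null_mult subst_alpha_null subst_eta_null)
  qed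
  then have "deg_poly ((poly_const c * alpha j + eta C i) ^ ?d) = lin_ext dragon_weight (?p ^ ?d)"
    unfolding deg_poly_def subst_poly_power
    by (intro lin_ext_eq_if_null dragon_null_power)
  also have "?p ^ ?d = (\<Sum>k\<le>?d. Poly_Mapping.single (replicate_mset k E + replicate_mset (?d - k) C)
      (of_nat (?d choose k) * c ^ k))"
  proof -
    have 1: "(Poly_Mapping.single 0 c * h_gen E) ^ k = Poly_Mapping.single (replicate_mset k E) (c ^ k)" for k
    proof -
      have "Poly_Mapping.single (0::'a set multiset) c ^ k = Poly_Mapping.single 0 (c ^ k)"
        by (induction k) (simp_all add: mult_single)
      then show ?thesis by (simp add: power_mult_distrib h_gen_power mult_single)
    qed
    show ?thesis
      unfolding binomial_ring 1 h_gen_power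
      by (intro sum.cong refl) (simp add: single_of_nat[symmetric] mult_single del: single_of_nat)
  qed
  also have "lin_ext dragon_weight \<dots> = (\<Sum>k\<le>?d. of_nat (?d choose k) * c ^ k * w k)"
    by (simp add: lin_ext_sum w_def)
  also have "\<dots> < (\<Sum>k\<le>?d. of_nat (?d choose k) * c ^ k)"
  proof (rule sum_strict_mono_ex1)
    show "\<forall>k\<in>{..?d}. of_nat (?d choose k) * c ^ k * w k \<le> of_nat (?d choose k) * c ^ k"
      using c by (auto simp: w_def dragon_weight_def)
    have "\<not> dragon (replicate_mset ?d C)"
    proof
      \<comment> \<open>A positive exponent makes the multiset of copies of \<open>C\<close>
        nonempty, so that the dragon condition applies to it.\<close>
      have dpos: "?d \<noteq> 0" using C by linarith
      assume "dragon (replicate_mset ?d C)"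
      from dragonD[OF this subset_mset.order_refl]
      have "size (replicate_mset ?d C) < rk (\<Union>(set_mset (replicate_mset ?d C)))"
        using dpos by (metis size_empty size_replicate_mset)
      moreover have "set_mset (replicate_mset ?d C) = {C}" using dpos by simp
      ultimately have "?d < rk C" by simp
      then show False using C by simp
    qed
    \<comment> \<open>The term \<open>k = 0\<close> has coefficient 1 even for \<open>c = 0\<close>,
      so its loss makes the inequality strict.\<close>
    then show "\<exists>k\<in>{..?d}. of_nat (?d choose k) * c ^ k * w k < of_nat (?d choose k) * c ^ k"
      by (intro bexI[of _ 0]) (auto simp: w_def dragon_weight_def)
  qed simp
  also have "\<dots> = (c + 1) ^ ?d"
    by (simp add: binomial_ring)
  finally show ?thesis .
qed

end

section \<open>The Chow ideal\<close>

context matroid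
begin

lemma flat_ring_simps [simp]:
  "monoid.mult flat_ring = (*)" "monoid.one flat_ring = 1" "ring.zero flat_ring = 0" "ring.add flat_ring = (+)"
  by (simp_all add: flat_ring_def poly_ring_def)

lemma flat_ring_cring: "cring flat_ring"
  by (simp add: flat_ring_def poly_ring_cring)

lemma carrier_flat_ring:
  "p \<in> carrier flat_ring \<longleftrightarrow> (\<forall>m\<in>Poly_Mapping.keys p. Poly_Mapping.keys m \<subseteq> proper_flats)"
  by (simp add: flat_ring_def poly_ring_def)

lemma flat_ring_add: "p \<in> carrier flat_ring \<Longrightarrow> q \<in> carrier flat_ring \<Longrightarrow> p + q \<in> carrier flat_ring"
  using cring.cring_simprules(1)[OF flat_ring_cring, of p q] by simp

lemma flat_ring_mult: "p \<in> carrier flat_ring \<Longrightarrow> q \<in> carrier flat_ring \<Longrightarrow> p * q \<in> carrier flat_ring"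
  using cring.cring_simprules(5)[OF flat_ring_cring, of p q] by simp

lemma flat_ring_const: "poly_const c \<in> carrier flat_ring"
  by (auto simp: carrier_flat_ring poly_const_def split: if_splits)

lemma flat_ring_0: "0 \<in> carrier flat_ring"
  and flat_ring_1: "1 \<in> carrier flat_ring"
  using flat_ring_const[of 0] flat_ring_const[of 1] by simp_all

lemma flat_ring_uminus: "p \<in> carrier flat_ring \<Longrightarrow> - p \<in> carrier flat_ring"
  by (simp add: carrier_flat_ring)

lemma flat_ring_diff: "p \<in> carrier flat_ring \<Longrightarrow> q \<in> carrier flat_ring \<Longrightarrow> p - q \<in> carrier flat_ring"
  using flat_ring_add[of p "- q"] flat_ring_uminus[of q] by simp

lemma flat_ring_var: "F \<in> proper_flats \<Longrightarrow> poly_var F \<in> carrier flat_ring"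
  by (auto simp: carrier_flat_ring poly_var_def split: if_splits)

lemma flat_ring_sum: "(\<And>a. a \<in> A \<Longrightarrow> f a \<in> carrier flat_ring) \<Longrightarrow> sum f A \<in> carrier flat_ring"
  by (induction A rule: infinite_finite_induct) (auto intro: flat_ring_add flat_ring_0)

lemma flat_ring_prod: "(\<And>a. a \<in> A \<Longrightarrow> f a \<in> carrier flat_ring) \<Longrightarrow> prod f A \<in> carrier flat_ring"
  by (induction A rule: infinite_finite_induct) (auto intro: flat_ring_mult flat_ring_1)

lemma flat_ring_power: "p \<in> carrier flat_ring \<Longrightarrow> p ^ k \<in> carrier flat_ring"
  by (induction k) (auto intro: flat_ring_mult flat_ring_1)

lemma flat_ring_alpha: "alpha i \<in> carrier flat_ring"
  unfolding alpha_def by (intro flat_ring_sum flat_ring_var) auto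

lemma flat_ring_eta: "eta C i \<in> carrier flat_ring"
  unfolding eta_def by (intro flat_ring_sum flat_ring_var) auto

lemmas flat_ring_closed = flat_ring_add flat_ring_mult flat_ring_const flat_ring_0 flat_ring_1
  flat_ring_uminus flat_ring_diff flat_ring_var flat_ring_sum flat_ring_prod flat_ring_power
  flat_ring_alpha flat_ring_eta

lemma flat_ring_idealI:
  assumes "I \<subseteq> carrier flat_ring" "0 \<in> I" "\<And>p q. p \<in> I \<Longrightarrow> q \<in> I \<Longrightarrow> p + q \<in> I"
    and "\<And>p q. p \<in> I \<Longrightarrow> q \<in> carrier flat_ring \<Longrightarrow> q * p \<in> I"
  shows "ideal I flat_ring"
proof (rule idealI)
  interpret cring flat_ring by (rule flat_ring_cring)
  show "ring flat_ring" ..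
  show "subgroup I (add_monoid flat_ring)"
  proof (rule add.subgroupI)
    fix p assume p: "p \<in> I"
    have "- p \<in> I"
      using assms(4)[OF p, of "- 1"] by (simp add: flat_ring_closed)
    moreover have "\<ominus>\<^bsub>flat_ring\<^esub> p = - p"
      using p assms(1) by (intro minus_equality) (auto intro: flat_ring_closed)
    ultimately show "\<ominus>\<^bsub>flat_ring\<^esub> p \<in> I" by simp
  qed (use assms in auto)
qed (use assms(4) in \<open>auto simp: mult.commute\<close>)

lemma chow_gens_carrier:
  "incomparable_gens \<subseteq> carrier flat_ring" "linear_gens \<subseteq> carrier flat_ring"
  by (auto simp: incomparable_gens_def linear_gens_def intro!: flat_ring_closed)

lemma chow_ideal_ideal: "ideal chow_ideal flat_ring"
proof -
  interpret cring flat_ring by (rule flat_ring_cring)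
  show ?thesis
    unfolding chow_ideal_def by (intro add_ideals genideal_ideal chow_gens_carrier)
qed

lemma chow_ideal_carrier: "p \<in> chow_ideal \<Longrightarrow> p \<in> carrier flat_ring"
  using ideal.Icarr[OF chow_ideal_ideal] by blast

lemma chow_ideal_0: "0 \<in> chow_ideal"
  using additive_subgroup.zero_closed[OF ideal.axioms(1)[OF chow_ideal_ideal]] by simp

lemma chow_ideal_add: "p \<in> chow_ideal \<Longrightarrow> q \<in> chow_ideal \<Longrightarrow> p + q \<in> chow_ideal"
  using additive_subgroup.a_closed[OF ideal.axioms(1)[OF chow_ideal_ideal], of p q] by simp

lemma chow_ideal_mult: "p \<in> chow_ideal \<Longrightarrow> q \<in> carrier flat_ring \<Longrightarrow> q * p \<in> chow_ideal"
  using ideal.I_l_closed[OF chow_ideal_ideal, of p q] by simp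

lemma chow_ideal_uminus: "p \<in> chow_ideal \<Longrightarrow> - p \<in> chow_ideal"
  using chow_ideal_mult[of p "- 1"] by (simp add: flat_ring_closed)

lemma chow_ideal_diff: "p \<in> chow_ideal \<Longrightarrow> q \<in> chow_ideal \<Longrightarrow> p - q \<in> chow_ideal"
  using chow_ideal_add[of p "- q"] chow_ideal_uminus[of q] by simp

lemma chow_ideal_sum: "(\<And>a. a \<in> A \<Longrightarrow> f a \<in> chow_ideal) \<Longrightarrow> sum f A \<in> chow_ideal"
  by (induction A rule: infinite_finite_induct) (auto intro: chow_ideal_add chow_ideal_0)

lemma mem_chow_ideal:
  "p \<in> chow_ideal \<longleftrightarrow>
    (\<exists>a\<in>Idl\<^bsub>flat_ring\<^esub> incomparable_gens. \<exists>b\<in>Idl\<^bsub>flat_ring\<^esub> linear_gens. p = a + b)"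
  by (auto simp: chow_ideal_def set_add_def')

lemma chow_ideal_incomparable:
  assumes "F \<in> proper_flats" "G \<in> proper_flats" "\<not> F \<subseteq> G" "\<not> G \<subseteq> F"
  shows "poly_var F * poly_var G \<in> chow_ideal"
proof -
  interpret cring flat_ring by (rule flat_ring_cring)
  have "poly_var F * poly_var G \<in> incomparable_gens"
    using assms by (auto simp: incomparable_gens_def)
  then have "poly_var F * poly_var G \<in> Idl\<^bsub>flat_ring\<^esub> incomparable_gens"
    using genideal_self[OF chow_gens_carrier(1)] by blast
  moreover have "0 \<in> Idl\<^bsub>flat_ring\<^esub> linear_gens"
    using additive_subgroup.zero_closed[OF ideal.axioms(1)[OF genideal_ideal[OF chow_gens_carrier(2)]]]
    by simp
  ultimately show ?thesis unfolding mem_chow_ideal by force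
qed

lemma chow_ideal_alpha:
  assumes "i \<in> E" "j \<in> E"
  shows "alpha i - alpha j \<in> chow_ideal"
proof -
  interpret cring flat_ring by (rule flat_ring_cring)
  have "alpha i - alpha j \<in> linear_gens"
    unfolding linear_gens_def alpha_def using assms by blast
  then have "alpha i - alpha j \<in> Idl\<^bsub>flat_ring\<^esub> linear_gens"
    using genideal_self[OF chow_gens_carrier(2)] by blast
  moreover have "0 \<in> Idl\<^bsub>flat_ring\<^esub> incomparable_gens"
    using additive_subgroup.zero_closed[OF ideal.axioms(1)[OF genideal_ideal[OF chow_gens_carrier(1)]]]
    by simp
  ultimately show ?thesis unfolding mem_chow_ideal by force
qed

text \<open>The polynomials of the flat ring with null image form an ideal \<open>Z\<close> that
  contains both families of generators, hence both generated ideals.\<close>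

lemma chow_ideal_null:
  assumes "p \<in> chow_ideal"
  shows "dragon_null (subst_poly x_img p)"
proof -
  interpret cring flat_ring by (rule flat_ring_cring)
  define Z where "Z = {p \<in> carrier flat_ring. dragon_null (subst_poly x_img p)}"
  have "subst_poly x_img 0 = 0"
    using subst_poly_const[of x_img 0] by simp
  then have Z: "ideal Z flat_ring"
    by (intro flat_ring_idealI)
      (auto simp: Z_def subst_poly_add subst_poly_mult intro: flat_ring_closed dragon_null_add dragon_null_mult)
  have "incomparable_gens \<subseteq> Z"
  proof
    fix g assume g: "g \<in> incomparable_gens"
    then obtain F G where FG: "F \<in> proper_flats" "G \<in> proper_flats" "\<not> F \<subseteq> G" "\<not> G \<subseteq> F"
      and g_eq: "g = poly_var F * poly_var G"
      unfolding incomparable_gens_def by blast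
    have "dragon_null (x_img F * x_img G)"
      using FG by (intro x_img_incomparable_null proper_flatD(2))
    then show "g \<in> Z"
      using g chow_gens_carrier by (auto simp: Z_def g_eq subst_poly_mult subst_poly_var)
  qed
  moreover have "linear_gens \<subseteq> Z"
  proof
    fix g assume g: "g \<in> linear_gens"
    then obtain i j where ij: "i \<in> E" "j \<in> E" and g_eq: "g = alpha i - alpha j"
      by (auto simp: linear_gens_def alpha_def)
    have eq: "subst_poly x_img g =
        (subst_poly x_img (alpha i) - h_gen E) - (subst_poly x_img (alpha j) - h_gen E)"
      by (simp add: g_eq subst_poly_diff)
    have "dragon_null (subst_poly x_img g)"
      unfolding eq by (intro dragon_null_diff subst_alpha_null ij)
    then show "g \<in> Z" using g chow_gens_carrier by (auto simp: Z_def)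
  qed
  ultimately have "Idl\<^bsub>flat_ring\<^esub> incomparable_gens \<subseteq> Z" "Idl\<^bsub>flat_ring\<^esub> linear_gens \<subseteq> Z"
    using genideal_minimal[OF Z] by auto
  then show ?thesis
    using assms by (auto simp: mem_chow_ideal Z_def subst_poly_add intro!: dragon_null_add)
qed

section \<open>Congruence modulo the Chow ideal\<close>

definition chow_cong :: "'a set mpoly \<Rightarrow> 'a set mpoly \<Rightarrow> bool" where
  "chow_cong p q \<longleftrightarrow> p - q \<in> chow_ideal"

lemma chow_cong_refl: "chow_cong p p"
  by (simp add: chow_cong_def chow_ideal_0)

lemma chow_cong_sym: "chow_cong p q \<Longrightarrow> chow_cong q p"
  unfolding chow_cong_def using chow_ideal_uminus by fastforce

lemma chow_cong_trans [trans]: "chow_cong p q \<Longrightarrow> chow_cong q s \<Longrightarrow> chow_cong p s"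
  unfolding chow_cong_def using chow_ideal_add[of "p - q" "q - s"] by simp

lemma chow_cong_add: "chow_cong p p' \<Longrightarrow> chow_cong q q' \<Longrightarrow> chow_cong (p + q) (p' + q')"
  unfolding chow_cong_def using chow_ideal_add[of "p - p'" "q - q'"] by (simp add: algebra_simps)

lemma chow_cong_diff: "chow_cong p p' \<Longrightarrow> chow_cong q q' \<Longrightarrow> chow_cong (p - q) (p' - q')"
  unfolding chow_cong_def using chow_ideal_diff[of "p - p'" "q - q'"] by (simp add: algebra_simps)

lemma chow_cong_mult: "chow_cong p p' \<Longrightarrow> q \<in> carrier flat_ring \<Longrightarrow> chow_cong (q * p) (q * p')"
  unfolding chow_cong_def using chow_ideal_mult[of "p - p'" q] by (simp add: algebra_simps)

lemma chow_cong_sum: "(\<And>a. a \<in> A \<Longrightarrow> chow_cong (f a) (g a)) \<Longrightarrow> chow_cong (sum f A) (sum g A)"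
  unfolding chow_cong_def sum_subtractf[symmetric] by (rule chow_ideal_sum)

lemma chow_cong_power:
  assumes "chow_cong p q" "p \<in> carrier flat_ring" "q \<in> carrier flat_ring"
  shows "chow_cong (p ^ k) (q ^ k)"
proof -
  have "(\<Sum>i<k. p ^ i * q ^ (k - Suc i)) * (p - q) \<in> chow_ideal"
    using assms unfolding chow_cong_def by (intro chow_ideal_mult flat_ring_closed)
  then show ?thesis
    by (simp add: chow_cong_def power_diff_sumr2 mult.commute)
qed

lemma chow_cong_alpha: "i \<in> E \<Longrightarrow> j \<in> E \<Longrightarrow> chow_cong (alpha i) (alpha j)"
  by (simp add: chow_cong_def chow_ideal_alpha)

text \<open>\<open>alpha i\<close> and \<open>eta C i\<close> differ by the sum over the flats
  containing \<open>C\<close>, which does not depend on \<open>i\<close>.\<close>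

lemma chow_cong_eta:
  assumes "i \<in> C" "j \<in> C" "C \<subseteq> E"
  shows "chow_cong (eta C i) (eta C j)"
proof -
  have "eta C i - eta C j = alpha i - alpha j"
    using assms by (simp add: alpha_eq_eta)
  then show ?thesis
    using chow_ideal_alpha[of i j] assms by (auto simp: chow_cong_def)
qed

lemma deg_poly_cong: "chow_cong p q \<Longrightarrow> deg_poly p = deg_poly q"
  unfolding chow_cong_def deg_poly_def
  by (intro lin_ext_eq_if_null) (simp add: subst_poly_diff[symmetric] chow_ideal_null)

text \<open>Exchanging the sums turns an additive weight into a combination of the
  \<open>alpha i\<close>, all congruent to \<open>alpha j\<close>. A divisor may thus be shifted by
  an additive function at the cost of a multiple of \<open>alpha\<close>.\<close>

lemma chow_cong_additive_weight:
  assumes "j \<in> E"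
  shows "chow_cong (\<Sum>F\<in>proper_flats. poly_const (\<Sum>i\<in>F. w i) * poly_var F)
    (poly_const (\<Sum>i\<in>E. w i) * alpha j)"
proof -
  have "(\<Sum>F\<in>proper_flats. poly_const (\<Sum>i\<in>F. w i) * poly_var F) =
      (\<Sum>F\<in>proper_flats. \<Sum>i\<in>{i\<in>E. i \<in> F}. poly_const (w i) * poly_var F)"
  proof (rule sum.cong)
    fix F assume "F \<in> proper_flats"
    then have "{i\<in>E. i \<in> F} = F" using proper_flatD(2) by auto
    then show "poly_const (\<Sum>i\<in>F. w i) * poly_var F =
        (\<Sum>i\<in>{i\<in>E. i \<in> F}. poly_const (w i) * poly_var F)"
      by (simp add: poly_const_sum sum_distrib_right)
  qed simp
  also have "\<dots> = (\<Sum>i\<in>E. \<Sum>F\<in>{F\<in>proper_flats. i \<in> F}. poly_const (w i) * poly_var F)"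
    by (rule sum.swap_restrict) (rule finite_proper_flats finite_ground)+
  also have "\<dots> = (\<Sum>i\<in>E. poly_const (w i) * alpha i)"
    by (simp add: alpha_def sum_distrib_left)
  also have "chow_cong \<dots> (\<Sum>i\<in>E. poly_const (w i) * alpha j)"
    by (intro chow_cong_sum chow_cong_mult chow_cong_alpha flat_ring_closed assms)
  finally show ?thesis
    by (simp add: poly_const_sum sum_distrib_right)
qed

section \<open>Combinations of chains of flats\<close>

abbreviation flat_chain :: "'a set set \<Rightarrow> bool" where
  "flat_chain C \<equiv> subset.chain proper_flats C"

abbreviation chain_prod :: "'a set set \<Rightarrow> 'a set mpoly" where
  "chain_prod C \<equiv> (\<Prod>F\<in>C. poly_var F)"

lemma flat_chain_finite: "flat_chain C \<Longrightarrow> finite C"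
  using finite_proper_flats finite_subset by (auto simp: subset_chain_def)

lemma flat_chain_subset: "flat_chain C \<Longrightarrow> F \<in> C \<Longrightarrow> F \<in> proper_flats"
  by (auto simp: subset_chain_def)

lemma flat_ring_chain_prod: "flat_chain C \<Longrightarrow> chain_prod C \<in> carrier flat_ring"
  by (intro flat_ring_closed flat_chain_subset)

text \<open>Combinations, modulo the Chow ideal, of squarefree monomials on chains of
  \<open>k\<close> flats. \<open>S = UNIV\<close> expresses spanning, \<open>S = {0..}\<close>
  effectivity.\<close>

inductive chain_comb :: "real set \<Rightarrow> nat \<Rightarrow> 'a set mpoly \<Rightarrow> bool" for S k where
  ideal: "p \<in> chow_ideal \<Longrightarrow> chain_comb S k p"
| add: "flat_chain C \<Longrightarrow> card C = k \<Longrightarrow> c \<in> S \<Longrightarrow> chain_comb S k p \<Longrightarrow>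
    chain_comb S k (poly_const c * chain_prod C + p)"

lemma chain_comb_add_ideal: "chain_comb S k p \<Longrightarrow> q \<in> chow_ideal \<Longrightarrow> chain_comb S k (p + q)"
  by (induction rule: chain_comb.induct)
    (auto simp: add.assoc intro: chain_comb.intros chow_ideal_add)

lemma chain_comb_add: "chain_comb S k p \<Longrightarrow> chain_comb S k q \<Longrightarrow> chain_comb S k (p + q)"
proof (induction rule: chain_comb.induct)
  case (ideal p)
  then show ?case using chain_comb_add_ideal[of S k q p] by (simp add: add.commute)
qed (auto simp: add.assoc intro: chain_comb.intros)

lemma chain_comb_0: "chain_comb S k 0"
  by (intro chain_comb.ideal chow_ideal_0)

lemma chain_comb_sum: "(\<And>a. a \<in> A \<Longrightarrow> chain_comb S k (f a)) \<Longrightarrow> chain_comb S k (sum f A)"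
  by (induction A rule: infinite_finite_induct) (auto intro: chain_comb_add chain_comb_0)

lemma chain_comb_cong: "chain_comb S k q \<Longrightarrow> chow_cong p q \<Longrightarrow> chain_comb S k p"
  using chain_comb_add_ideal[of S k q "p - q"] by (simp add: chow_cong_def)

lemma chain_comb_chain:
  "flat_chain C \<Longrightarrow> card C = k \<Longrightarrow> c \<in> S \<Longrightarrow> chain_comb S k (poly_const c * chain_prod C)"
  using chain_comb.add[OF _ _ _ chain_comb_0] by simp

lemma chain_comb_scale:
  assumes "chain_comb S k p" "c \<in> S" "\<And>a b. a \<in> S \<Longrightarrow> b \<in> S \<Longrightarrow> a * b \<in> S"
  shows "chain_comb S k (poly_const c * p)"
  using assms(1)
proof (induction rule: chain_comb.induct)
  case (ideal p)
  then show ?case by (intro chain_comb.ideal chow_ideal_mult flat_ring_closed)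
next
  case (add C b p)
  have "poly_const c * (poly_const b * chain_prod C + p) =
      poly_const (c * b) * chain_prod C + poly_const c * p"
    by (simp add: poly_const_mult algebra_simps)
  then show ?case using add assms by (auto intro: chain_comb.intros)
qed

lemma chain_comb_mult:
  assumes "chain_comb S k p" "g \<in> carrier flat_ring" "\<And>a b. a \<in> S \<Longrightarrow> b \<in> S \<Longrightarrow> a * b \<in> S"
    and "\<And>C. flat_chain C \<Longrightarrow> card C = k \<Longrightarrow> chain_comb S l (g * chain_prod C)"
  shows "chain_comb S l (g * p)"
  using assms(1)
proof (induction rule: chain_comb.induct)
  case (ideal p)
  then show ?case using assms(2) by (intro chain_comb.ideal chow_ideal_mult)
next
  case (add C c p)
  have "g * (poly_const c * chain_prod C + p) =
      poly_const c * (g * chain_prod C) + g * p"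
    by (simp add: algebra_simps)
  then show ?case using add assms(3,4) by (auto intro!: chain_comb_add chain_comb_scale)
qed

text \<open>A linear factor that sends each chain to longer chains can be applied repeatedly; with
  \<open>S = {0..}\<close> this is how nefness is used.\<close>

lemma chain_comb_power_mult:
  assumes "chain_comb S k p" "g \<in> carrier flat_ring" "\<And>a b. a \<in> S \<Longrightarrow> b \<in> S \<Longrightarrow> a * b \<in> S"
    and "\<And>C. flat_chain C \<Longrightarrow> chain_comb S (Suc (card C)) (g * chain_prod C)"
  shows "chain_comb S (k + j) (g ^ j * p)"
proof (induction j)
  case (Suc j)
  have "chain_comb S (Suc (k + j)) (g * (g ^ j * p))"
  proof (rule chain_comb_mult[OF Suc assms(2,3)])
    fix C assume "flat_chain C" "card C = k + j"
    then show "chain_comb S (Suc (k + j)) (g * chain_prod C)"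
      using assms(4)[of C] by (simp only:)
  qed
  then show ?case by (simp add: mult.assoc)
qed (use assms(1) in simp)

text \<open>Flats comparable to all of \<open>C\<close> lengthen the chain, the others give products
  in the ideal, and vanishing on \<open>C\<close> excludes squares.\<close>

lemma chain_comb_linear_form:
  assumes C: "flat_chain C" and a: "\<And>F. F \<in> proper_flats \<Longrightarrow> a F \<in> S" "\<And>F. F \<in> C \<Longrightarrow> a F = 0"
  shows "chain_comb S (Suc (card C)) ((\<Sum>F\<in>proper_flats. poly_const (a F) * poly_var F) * chain_prod C)"
  unfolding sum_distrib_right
proof (rule chain_comb_sum)
  fix F assume F: "F \<in> proper_flats"
  consider "F \<in> C" | "F \<notin> C" "\<forall>G\<in>C. F \<subseteq> G \<or> G \<subseteq> F" | G where "G \<in> C" "\<not> F \<subseteq> G" "\<not> G \<subseteq> F"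
    by blast
  then show "chain_comb S (Suc (card C)) (poly_const (a F) * poly_var F * chain_prod C)"
  proof cases
    case 1
    then show ?thesis by (simp add: a chain_comb_0)
  next
    case 2
    have "flat_chain (insert F C)"
      using C F 2 by (auto simp: subset_chain_def)
    moreover have "card (insert F C) = Suc (card C)" "chain_prod (insert F C) = poly_var F * chain_prod C"
      using 2 flat_chain_finite[OF C] by simp_all
    ultimately show ?thesis
      using chain_comb_chain[of "insert F C" _ "a F"] a(1)[OF F] by (simp add: mult.assoc)
  next
    case 3
    have "chain_prod C = poly_var G * chain_prod (C - {G})"
      using 3 flat_chain_finite[OF C] by (simp add: prod.remove)
    then have "poly_const (a F) * poly_var F * chain_prod C =
        (poly_const (a F) * chain_prod (C - {G})) * (poly_var F * poly_var G)"
      by (simp add: algebra_simps)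
    moreover have "\<dots> \<in> chow_ideal"
      using 3 F C flat_chain_subset[OF C]
      by (intro chow_ideal_mult chow_ideal_incomparable flat_ring_closed) auto
    ultimately show ?thesis by (simp add: chain_comb.ideal)
  qed
qed

lemma flat_chain_Union:
  assumes "flat_chain C" "C \<noteq> {}"
  shows "\<Union>C \<in> C"
  using assms flat_chain_finite Union_in_chain by metis

lemma flat_chain_Inter:
  assumes "flat_chain C" "C \<noteq> {}"
  shows "\<Inter>C \<in> C"
  using assms flat_chain_finite Inter_in_chain by metis

lemma flat_chain_mono: "flat_chain C \<Longrightarrow> D \<subseteq> C \<Longrightarrow> flat_chain D"
  unfolding subset_chain_def by blast

lemma sum_poly_const_of_bool:
  "(\<Sum>F\<in>proper_flats. poly_const (of_bool (P F)) * poly_var F) = (\<Sum>F\<in>{F\<in>proper_flats. P F}. poly_var F)"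
proof -
  have "(\<Sum>F\<in>proper_flats. poly_const (of_bool (P F)) * poly_var F) =
      (\<Sum>F\<in>proper_flats. if P F then poly_var F else 0)"
    by (intro sum.cong) auto
  then show ?thesis using finite_proper_flats by (simp add: sum.inter_filter)
qed

text \<open>If \<open>F\<close> is already in the chain, its variable is moved off the chain by a
  linear relation: choose \<open>i\<close> in \<open>F\<close> outside all smaller members, and
  \<open>j\<close> outside \<open>F\<close> in all larger ones.\<close>

lemma chain_comb_var:
  assumes F: "F \<in> proper_flats" and C: "flat_chain C"
  shows "chain_comb UNIV (Suc (card C)) (poly_var F * chain_prod C)"
proof (cases "F \<in> C")
  case False
  have "(\<Sum>G\<in>proper_flats. poly_const (of_bool (G = F)) * poly_var G) = poly_var F"
  proof -
    have "{G \<in> proper_flats. G = F} = {F}" using F by auto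
    then show ?thesis by (simp only: sum_poly_const_of_bool) simp
  qed
  then show ?thesis
    using chain_comb_linear_form[OF C, of "\<lambda>G. of_bool (G = F)" UNIV] False by fastforce
next
  case True
  \<comment> \<open>The intersection with \<open>E\<close> covers the case of no larger member,
    where \<open>\<Inter>\<close> of the empty family is everything.\<close>
  let ?U = "\<Union>{G\<in>C. G \<subset> F}" and ?V = "E \<inter> \<Inter>{G\<in>C. F \<subset> G}"
  have "\<exists>i. i \<in> F \<and> i \<notin> ?U"
  proof (cases "{G\<in>C. G \<subset> F} = {}")
    case True
    then show ?thesis using proper_flatD(3)[OF F] by auto
  next
    case False
    then have "?U \<in> {G\<in>C. G \<subset> F}"
      using flat_chain_mono[OF C] by (intro flat_chain_Union) auto
    then show ?thesis by blast
  qed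
  then obtain i where i: "i \<in> F" "i \<notin> ?U" by blast
  have "\<exists>j. j \<in> ?V \<and> j \<notin> F"
  proof (cases "{G\<in>C. F \<subset> G} = {}")
    case True
    then show ?thesis using proper_flatD(2,4)[OF F] by auto
  next
    case False
    define B where "B = \<Inter>{G\<in>C. F \<subset> G}"
    have "B \<in> {G\<in>C. F \<subset> G}"
      unfolding B_def using flat_chain_mono[OF C] False by (intro flat_chain_Inter) auto
    moreover from this have "B \<subseteq> E"
      using flat_chain_subset[OF C] proper_flatD(2) by simp
    ultimately show ?thesis unfolding B_def[symmetric] by auto
  qed
  then obtain j where j: "j \<in> ?V" "j \<notin> F" by blast
  \<comment> \<open>These are the coefficients of \<open>poly_var F - alpha i + alpha j\<close>. On
    smaller members all three terms are zero, on larger ones the last two cancel, and at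
    \<open>F\<close> the first two cancel.\<close>
  define a where "a G = (of_bool (G = F) - of_bool (i \<in> G) + of_bool (j \<in> G) :: real)" for G
  have a0: "a G = 0" if G: "G \<in> C" for G
  proof -
    have "G = F \<or> G \<subset> F \<or> F \<subset> G"
      using G True C by (auto simp: subset_chain_def)
    then show ?thesis using G i j by (auto simp: a_def)
  qed
  have "(\<Sum>G\<in>proper_flats. poly_const (a G) * poly_var G) =
      (\<Sum>G\<in>proper_flats. poly_const (of_bool (G = F)) * poly_var G) -
      (\<Sum>G\<in>proper_flats. poly_const (of_bool (i \<in> G)) * poly_var G) +
      (\<Sum>G\<in>proper_flats. poly_const (of_bool (j \<in> G)) * poly_var G)"
    by (simp only: a_def poly_const_add poly_const_diff distrib_right left_diff_distrib
        sum.distrib sum_subtractf)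
  also have "\<dots> = poly_var F - alpha i + alpha j"
  proof -
    have "{G \<in> proper_flats. G = F} = {F}" using F by auto
    then show ?thesis by (simp only: sum_poly_const_of_bool alpha_def) simp
  qed
  finally have sum_eq: "(\<Sum>G\<in>proper_flats. poly_const (a G) * poly_var G) = poly_var F - alpha i + alpha j" .
  have "chain_comb UNIV (Suc (card C)) ((poly_var F - alpha i + alpha j) * chain_prod C)"
    unfolding sum_eq[symmetric] using a0 by (intro chain_comb_linear_form C) auto
  moreover have "chow_cong (poly_var F * chain_prod C) ((poly_var F - alpha i + alpha j) * chain_prod C)"
  proof -
    have "i \<in> E" "j \<in> E" using i j proper_flatD(2)[OF F] by auto
    then have "chain_prod C * (alpha i - alpha j) \<in> chow_ideal"
      by (intro chow_ideal_mult chow_ideal_alpha flat_ring_chain_prod C)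
    then show ?thesis by (simp add: chow_cong_def algebra_simps)
  qed
  ultimately show ?thesis by (rule chain_comb_cong)
qed

text \<open>Nefness of \<open>eta\<close>: the largest member not containing \<open>T\<close>, if
  there is one, misses some \<open>j\<close> in \<open>T\<close>. The congruent form
  \<open>eta T j\<close> has nonnegative coefficients and vanishes on the chain.\<close>

lemma chain_comb_eta:
  assumes C: "flat_chain C" and T: "T \<subseteq> E" "i \<in> T"
  shows "chain_comb {0..} (Suc (card C)) (eta T i * chain_prod C)"
proof -
  let ?D = "{G\<in>C. \<not> T \<subseteq> G}"
  have "\<exists>j\<in>T. \<forall>G\<in>C. j \<in> G \<longrightarrow> T \<subseteq> G"
  proof (cases "?D = {}")
    case True
    then show ?thesis using T by auto
  next
    case False
    then have *: "\<Union>?D \<in> ?D"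
      using flat_chain_mono[OF C] by (intro flat_chain_Union) auto
    then obtain j where "j \<in> T" "j \<notin> \<Union>?D" by blast
    then show ?thesis by blast
  qed
  then obtain j where j: "j \<in> T" "\<forall>G\<in>C. j \<in> G \<longrightarrow> T \<subseteq> G" by blast
  have "chain_comb {0..} (Suc (card C))
      ((\<Sum>G\<in>proper_flats. poly_const (of_bool (j \<in> G \<and> \<not> T \<subseteq> G)) * poly_var G) * chain_prod C)"
    using j by (intro chain_comb_linear_form C) auto
  then have "chain_comb {0..} (Suc (card C)) (eta T j * chain_prod C)"
    by (simp only: sum_poly_const_of_bool eta_def)
  moreover have "chow_cong (eta T i * chain_prod C) (eta T j * chain_prod C)"
    using chow_cong_mult[OF chow_cong_eta[OF T(2) j(1) T(1)] flat_ring_chain_prod[OF C]]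
    by (simp add: mult.commute)
  ultimately show ?thesis by (rule chain_comb_cong)
qed

text \<open>Makes the nefness of \<open>alpha\<close> an instance of
  \<open>chain_comb_eta\<close>.\<close>

lemma alpha_eq_eta_ground: "alpha i = eta E i"
proof -
  have "{F \<in> proper_flats. i \<in> F \<and> \<not> E \<subseteq> F} = {F \<in> proper_flats. i \<in> F}"
    using proper_flatD(2,4) by blast
  then show ?thesis by (simp only: alpha_def eta_def)
qed

definition rank_divisor :: "'a set mpoly" where
  "rank_divisor = (\<Sum>F\<in>proper_flats. poly_const (real (rk F)) * poly_var F)"

lemma flat_ring_rank_divisor: "rank_divisor \<in> carrier flat_ring"
  unfolding rank_divisor_def by (intro flat_ring_closed)

text \<open>Independent sets are extended along the chain from small flats to large ones, and
  finally to a basis. An extension cannot meet a smaller flat in more elements than its rank, so the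
  equalities already reached persist.\<close>

lemma ex_basis_adapted_to_chain:
  assumes "flat_chain C"
  shows "\<exists>B\<in>Ind. card B = rk E \<and> (\<forall>G\<in>C. card (B \<inter> G) = rk G)"
proof -
  have "\<exists>B\<in>Ind. B \<subseteq> \<Union>C \<and> (\<forall>G\<in>C. card (B \<inter> G) = rk G)"
    using assms
  proof (induction "card C" arbitrary: C)
    case 0
    then have "C = {}" using flat_chain_finite by auto
    then show ?case using indep_empty by auto
  next
    case (Suc k)
    have fin: "finite C" and ne: "C \<noteq> {}" using flat_chain_finite Suc by auto
    let ?T = "\<Union>C"
    have T: "?T \<in> C" using flat_chain_Union Suc.prems ne by blast
    have chain': "flat_chain (C - {?T})" using flat_chain_mono[OF Suc.prems] by auto
    obtain B where B: "B \<in> Ind" "B \<subseteq> \<Union>(C - {?T})" "\<forall>G\<in>C - {?T}. card (B \<inter> G) = rk G"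
      using Suc.hyps(1)[OF _ chain'] Suc.hyps(2)[symmetric] T fin by auto
    obtain B' where B': "B' \<in> Ind" "B \<subseteq> B'" "B' \<subseteq> ?T" "card B' = rk ?T"
      using indep_extend[OF B(1), of ?T] B(2) by blast
    have "card (B' \<inter> G) = rk G" if G: "G \<in> C" for G
    proof (cases "G = ?T")
      case True
      then show ?thesis using B' by (simp add: Int_absorb2)
    next
      case False
      have "card (B' \<inter> G) \<le> rk G"
        using indep_subset[OF B'(1), of "B' \<inter> G"] by (intro card_le_rk) auto
      moreover have "card (B \<inter> G) \<le> card (B' \<inter> G)"
        using B' indep_finite[OF B'(1)] by (intro card_mono) auto
      moreover have "card (B \<inter> G) = rk G" using B(3) False G by blast
      ultimately show ?thesis by simp
    qed
    then show ?case using B' by blast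
  qed
  then obtain B where B: "B \<in> Ind" "\<forall>G\<in>C. card (B \<inter> G) = rk G" by blast
  obtain B' where B': "B' \<in> Ind" "B \<subseteq> B'" "card B' = rk E"
    using indep_extend[OF B(1) indep_subset_ground[OF B(1)]] by blast
  have "card (B' \<inter> G) = rk G" if G: "G \<in> C" for G
  proof -
    have "card (B' \<inter> G) \<le> rk G"
      using indep_subset[OF B'(1), of "B' \<inter> G"] by (intro card_le_rk) auto
    moreover have "card (B \<inter> G) \<le> card (B' \<inter> G)"
      using B' indep_finite[OF B'(1)] by (intro card_mono) auto
    ultimately show ?thesis using B G by simp
  qed
  then show ?thesis using B' by blast
qed

text \<open>Subtracting the additive function \<open>F \<mapsto> card (F \<inter> B)\<close>, for a basis \<open>B\<close> adapted to the chain,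
  makes the rank function nonnegative and zero on the chain: this is the nefness of the divisor.\<close>

lemma chain_comb_rank_divisor:
  assumes C: "flat_chain C" and e: "e \<in> E"
  shows "chain_comb {0..} (Suc (card C)) (rank_divisor * chain_prod C)"
proof -
  obtain B where B: "B \<in> Ind" "card B = rk E" "\<forall>G\<in>C. card (B \<inter> G) = rk G"
    using ex_basis_adapted_to_chain[OF C] by blast
  define w where "w i = (of_bool (i \<in> B) :: real)" for i
  have sum_w: "(\<Sum>i\<in>F. w i) = real (card (B \<inter> F))" if "F \<subseteq> E" for F
    using finite_subset[OF that finite_ground] by (simp add: w_def sum.If_cases Int_commute)
  let ?a = "\<lambda>F. real (rk F) - (\<Sum>i\<in>F. w i)"
  let ?A = "\<Sum>F\<in>proper_flats. poly_const (?a F) * poly_var F"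
  have "chain_comb {0..} (Suc (card C)) (?A * chain_prod C)"
  proof (rule chain_comb_linear_form[OF C])
    fix F assume F: "F \<in> proper_flats"
    have "card (B \<inter> F) \<le> rk F"
      using indep_subset[OF B(1), of "B \<inter> F"] by (intro card_le_rk) auto
    then show "?a F \<in> {0..}" using sum_w proper_flatD(2)[OF F] by simp
  next
    fix F assume F: "F \<in> C"
    then show "?a F = 0"
      using B sum_w proper_flatD(2)[OF flat_chain_subset[OF C F]] by simp
  qed
  \<comment> \<open>The shift by the additive function costs \<open>rk E\<close> times
    \<open>alpha\<close>, which is itself nef.\<close>
  moreover have "chain_comb {0..} (Suc (card C)) (poly_const (real (rk E)) * (alpha e * chain_prod C))"
    unfolding alpha_eq_eta_ground using C e
    by (intro chain_comb_scale chain_comb_eta) auto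
  ultimately have "chain_comb {0..} (Suc (card C))
      (?A * chain_prod C + poly_const (real (rk E)) * (alpha e * chain_prod C))"
    by (rule chain_comb_add)
  moreover have "chow_cong (rank_divisor * chain_prod C)
      (?A * chain_prod C + poly_const (real (rk E)) * (alpha e * chain_prod C))"
  proof -
    have "B \<inter> E = B" using indep_subset_ground[OF B(1)] by blast
    then have "chow_cong (\<Sum>F\<in>proper_flats. poly_const (\<Sum>i\<in>F. w i) * poly_var F)
        (poly_const (real (rk E)) * alpha e)"
      using chow_cong_additive_weight[OF e, of w] B(2) sum_w[of E] by simp
    moreover have "rank_divisor = ?A + (\<Sum>F\<in>proper_flats. poly_const (\<Sum>i\<in>F. w i) * poly_var F)"
      by (simp add: rank_divisor_def sum.distrib[symmetric] distrib_right[symmetric]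
          poly_const_add[symmetric])
    ultimately have "chow_cong rank_divisor (?A + poly_const (real (rk E)) * alpha e)"
      by (simp add: chow_cong_add chow_cong_refl)
    from chow_cong_mult[OF this flat_ring_chain_prod[OF C]] show ?thesis
      by (simp add: algebra_simps)
  qed
  ultimately show ?thesis by (rule chain_comb_cong)
qed

text \<open>Each monomial is built one variable at a time; \<open>chain_comb_var\<close> keeps the
  products in the span of squarefree chains.\<close>

lemma chain_comb_homogeneous:
  assumes p: "p \<in> carrier flat_ring" "homogeneous k p"
  shows "chain_comb UNIV k p"
proof -
  have pow: "chain_comb UNIV (l + j) (poly_var F ^ j * q)"
    if "chain_comb UNIV l q" "F \<in> proper_flats" for l j q F
    using that by (intro chain_comb_power_mult chain_comb_var flat_ring_var) auto
  have mono: "chain_comb UNIV (\<Sum>v\<in>A. g v) (\<Prod>v\<in>A. poly_var v ^ g v)"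
    if "finite A" "A \<subseteq> proper_flats" for A and g :: "'a set \<Rightarrow> nat"
    using that
  proof (induction A)
    case empty
    have "flat_chain {}" by (simp add: subset_chain_def)
    from chain_comb_chain[OF this, of 0 1 UNIV] show ?case by simp
  next
    case (insert F A)
    then show ?case using pow[of "sum g A" "\<Prod>v\<in>A. poly_var v ^ g v" F "g F"] by (simp add: add.commute)
  qed
  have "chain_comb UNIV k (Poly_Mapping.single m c)"
    if m: "m \<in> Poly_Mapping.keys p" for m c
  proof -
    have "Poly_Mapping.keys m \<subseteq> proper_flats" using p m by (auto simp: carrier_flat_ring)
    from mono[OF finite_keys this, of "Poly_Mapping.lookup m"]
    have "chain_comb UNIV k (\<Prod>v\<in>Poly_Mapping.keys m. poly_var v ^ Poly_Mapping.lookup m v)"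
      using p m by (simp add: homogeneous_def)
    then show ?thesis
      unfolding single_eq_const_prod_vars[of m] by (intro chain_comb_scale) auto
  qed
  then show ?thesis
    by (subst poly_mapping_sum_singles) (intro chain_comb_sum)
qed

end

section \<open>The degree map\<close>

lemma monomial_degree_add:
  fixes a b :: "'v \<Rightarrow>\<^sub>0 nat"
  shows "(\<Sum>x\<in>Poly_Mapping.keys (a + b). Poly_Mapping.lookup (a + b) x) =
    (\<Sum>x\<in>Poly_Mapping.keys a. Poly_Mapping.lookup a x) + (\<Sum>x\<in>Poly_Mapping.keys b. Poly_Mapping.lookup b x)"
  by (rule setsum_keys_plus_distrib[of "\<lambda>_ c. c"]) auto

lemma homogeneous_add: "homogeneous k p \<Longrightarrow> homogeneous k q \<Longrightarrow> homogeneous k (p + q)"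
  unfolding homogeneous_def using Poly_Mapping.keys_add[of p q] by blast

lemma homogeneous_mult:
  assumes "homogeneous k p" "homogeneous l q"
  shows "homogeneous (k + l) (p * q)"
  unfolding homogeneous_def
proof
  fix m assume "m \<in> Poly_Mapping.keys (p * q)"
  then obtain a b where "m = a + b" "a \<in> Poly_Mapping.keys p" "b \<in> Poly_Mapping.keys q"
    using subsetD[OF Poly_Mapping.keys_mult] by blast
  then show "(\<Sum>x\<in>Poly_Mapping.keys m. Poly_Mapping.lookup m x) = k + l"
    using assms by (simp add: homogeneous_def monomial_degree_add)
qed

lemma homogeneous_const: "homogeneous 0 (poly_const c)"
  by (auto simp: homogeneous_def poly_const_def split: if_splits)

lemma homogeneous_var: "homogeneous 1 (poly_var v)"
  by (auto simp: homogeneous_def poly_var_def split: if_splits)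

lemma homogeneous_scale: "homogeneous k p \<Longrightarrow> homogeneous k (poly_const c * p)"
  using homogeneous_mult[OF homogeneous_const] by fastforce

lemma homogeneous_sum: "(\<And>a. a \<in> A \<Longrightarrow> homogeneous k (f a)) \<Longrightarrow> homogeneous k (sum f A)"
  by (induction A rule: infinite_finite_induct)
    (simp_all add: homogeneous_add, simp_all add: homogeneous_def)

lemma homogeneous_power: "homogeneous 1 p \<Longrightarrow> homogeneous k (p ^ k)"
proof (induction k)
  case 0
  then show ?case using homogeneous_const[of 1] by simp
next
  case (Suc k)
  then show ?case using homogeneous_mult[of 1 p k "p ^ k"] by simp
qed

lemma homogeneous_prod_vars: "finite A \<Longrightarrow> homogeneous (card A) (\<Prod>v\<in>A. poly_var v)"
proof (induction A rule: finite_induct)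
  case empty
  then show ?case using homogeneous_const[of 1] by simp
next
  case (insert v A)
  then show ?case using homogeneous_mult[OF homogeneous_var] by fastforce
qed

context matroid
begin

section \<open>Classes in the quotient ring\<close>

lemma mem_chow_class: "q \<in> chow_class p \<longleftrightarrow> q - p \<in> chow_ideal"
proof -
  have "q \<in> chow_class p \<longleftrightarrow> (\<exists>h\<in>chow_ideal. q = h + p)"
    by (auto simp: chow_class_def a_r_coset_def')
  then show ?thesis by (metis add_diff_cancel diff_add_cancel)
qed

lemma chow_class_eq_iff: "chow_class p = chow_class q \<longleftrightarrow> chow_cong p q"
proof
  assume "chow_class p = chow_class q"
  moreover have "p \<in> chow_class p" by (simp add: mem_chow_class chow_ideal_0)
  ultimately show "chow_cong p q" by (simp add: mem_chow_class chow_cong_def)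
next
  assume pq: "chow_cong p q"
  have "chow_cong s p \<longleftrightarrow> chow_cong s q" for s
    using pq chow_cong_trans chow_cong_sym by blast
  then show "chow_class p = chow_class q"
    by (auto simp: mem_chow_class chow_cong_def)
qed

lemma chow_class_hom: "ring_hom_cring flat_ring chow_ring chow_class"
proof -
  have "chow_class = (+>\<^bsub>flat_ring\<^esub>) chow_ideal" by (auto simp: chow_class_def)
  then show ?thesis
    using ideal.rcos_ring_hom_cring[OF chow_ideal_ideal flat_ring_cring]
    by (simp add: chow_ring_def)
qed

lemma chow_class_add:
  "p \<in> carrier flat_ring \<Longrightarrow> q \<in> carrier flat_ring \<Longrightarrow>
    chow_class p \<oplus>\<^bsub>chow_ring\<^esub> chow_class q = chow_class (p + q)"
  using ring_hom_add[OF ring_hom_cring.homh[OF chow_class_hom], of p q] by simp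

lemma chow_class_mult:
  "p \<in> carrier flat_ring \<Longrightarrow> q \<in> carrier flat_ring \<Longrightarrow>
    chow_class p \<otimes>\<^bsub>chow_ring\<^esub> chow_class q = chow_class (p * q)"
  using ring_hom_mult[OF ring_hom_cring.homh[OF chow_class_hom], of p q] by simp

lemma chow_class_scale:
  "p \<in> carrier flat_ring \<Longrightarrow> chow_scale c (chow_class p) = chow_class (poly_const c * p)"
  by (simp add: chow_scale_def chow_class_mult flat_ring_const)

lemma chow_class_closed: "p \<in> carrier flat_ring \<Longrightarrow> chow_class p \<in> carrier chow_ring"
  using ring_hom_closed[OF ring_hom_cring.homh[OF chow_class_hom]] by simp

lemma chow_class_one: "chow_class 1 = \<one>\<^bsub>chow_ring\<^esub>"
  using ring_hom_one[OF ring_hom_cring.homh[OF chow_class_hom]] by simp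

lemma chow_class_zero: "chow_class 0 = \<zero>\<^bsub>chow_ring\<^esub>"
proof -
  interpret ring_hom_cring flat_ring chow_ring chow_class by (rule chow_class_hom)
  show ?thesis using hom_zero by simp
qed

lemma chow_class_sum:
  assumes "finite A" "\<And>a. a \<in> A \<Longrightarrow> f a \<in> carrier flat_ring"
  shows "(\<Oplus>\<^bsub>chow_ring\<^esub>a\<in>A. chow_class (f a)) = chow_class (sum f A)"
  using assms
proof (induction A rule: finite_induct)
  interpret ring_hom_cring flat_ring chow_ring chow_class by (rule chow_class_hom)
  {
    case empty
    then show ?case by (simp add: chow_class_zero)
  next
    case (insert a A)
    then show ?case
      by (subst S.finsum_insert) (auto simp: chow_class_closed chow_class_add flat_ring_sum)
  }
qed

lemma chow_class_prod:
  assumes "finite A" "\<And>a. a \<in> A \<Longrightarrow> f a \<in> carrier flat_ring"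
  shows "(\<Otimes>\<^bsub>chow_ring\<^esub>a\<in>A. chow_class (f a)) = chow_class (prod f A)"
  using assms
proof (induction A rule: finite_induct)
  interpret ring_hom_cring flat_ring chow_ring chow_class by (rule chow_class_hom)
  {
    case empty
    then show ?case by (simp add: chow_class_one)
  next
    case (insert a A)
    then show ?case
      by (subst S.finprod_insert) (auto simp: chow_class_closed chow_class_mult flat_ring_prod)
  }
qed

lemma chow_class_power:
  assumes "p \<in> carrier flat_ring"
  shows "chow_class p [^]\<^bsub>chow_ring\<^esub> k = chow_class (p ^ k)"
proof (induction k)
  interpret ring_hom_cring flat_ring chow_ring chow_class by (rule chow_class_hom)
  {
    case 0
    then show ?case by (simp add: chow_class_one)
  next
    case (Suc k)
    then show ?case
      by (simp add: chow_class_mult assms flat_ring_power mult.commute)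
  }
qed

lemma chow_gradedE:
  assumes "a \<in> chow_graded k"
  obtains p where "p \<in> carrier flat_ring" "homogeneous k p" "a = chow_class p"
  using assms by (auto simp: chow_graded_def)

lemma chow_gradedI: "p \<in> carrier flat_ring \<Longrightarrow> homogeneous k p \<Longrightarrow> chow_class p \<in> chow_graded k"
  by (auto simp: chow_graded_def)

section \<open>The top degree of a loopless matroid\<close>

context
  fixes e :: 'a
  assumes loopless: loopless and e: "e \<in> E"
begin

lemma flat_empty: "flat {}"
  using loopless by (simp add: loopless_def)

lemma rk_pos: "X \<noteq> {} \<Longrightarrow> X \<subseteq> E \<Longrightarrow> 0 < rk X"
  using flat_subset_eq[OF flat_empty, of X] by auto

text \<open>Represent one factor \<open>alpha e\<close> by some \<open>i\<close> outside
  \<open>F\<close>. A flat containing \<open>i\<close> is incomparable with \<open>F\<close> or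
  strictly larger; in the second case the rank grows by at least 1 while the exponent drops by 1,
  and induction applies.\<close>

lemma alpha_power_kill:
  assumes "F \<in> proper_flats" "rk E \<le> j + rk F"
  shows "alpha e ^ j * poly_var F \<in> chow_ideal"
  using assms
proof (induction "rk E - rk F" arbitrary: F j rule: less_induct)
  case less
  note F = proper_flatD[OF less.prems(1)]
  obtain l where j: "j = Suc l"
    using F(5) less.prems(2) by (cases j) auto
  obtain i where i: "i \<in> E" "i \<notin> F" using F by blast
  let ?p = "alpha e ^ l * poly_var F"
  have p: "?p \<in> carrier flat_ring"
    by (intro flat_ring_closed less.prems)
  have "?p * poly_var G \<in> chow_ideal" if G: "G \<in> proper_flats" "i \<in> G" for G
  proof (cases "F \<subseteq> G")
    case True
    then have "rk F < rk G"
      using flat_subset_eq[of F G] F G i proper_flatD[OF G(1)] by (metis not_le)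
    then have "alpha e ^ l * poly_var G \<in> chow_ideal"
      using less.prems j proper_flatD(5)[OF G(1)] by (intro less.hyps G) auto
    then have "poly_var F * (alpha e ^ l * poly_var G) \<in> chow_ideal"
      using less.prems(1) by (rule chow_ideal_mult[OF _ flat_ring_var])
    then show ?thesis by (simp add: ac_simps)
  next
    case False
    have "\<not> G \<subseteq> F" using i G by blast
    then have "alpha e ^ l * (poly_var F * poly_var G) \<in> chow_ideal"
      using False by (intro chow_ideal_mult chow_ideal_incomparable flat_ring_closed less.prems G)
    then show ?thesis by (simp add: ac_simps)
  qed
  then have "?p * alpha i \<in> chow_ideal"
    unfolding alpha_def[of i] sum_distrib_left by (intro chow_ideal_sum) auto
  moreover have "?p * alpha e - ?p * alpha i \<in> chow_ideal"
    using chow_cong_mult[OF chow_cong_alpha[OF e i(1)] p] by (simp add: chow_cong_def)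
  ultimately have "?p * alpha e \<in> chow_ideal"
    using chow_ideal_add by fastforce
  then show ?case by (simp add: j ac_simps)
qed

text \<open>Each flat of a complete flag is exchanged for a factor \<open>alpha e\<close>. With
  \<open>i\<close> in the flat of rank \<open>k + 1\<close> but in no smaller member, every other
  flat containing \<open>i\<close> is killed, by incomparability or by
  \<open>alpha_power_kill\<close>.\<close>

lemma flag_cong_alpha_power:
  assumes C: "flat_chain C" and ranks: "rk ` C = {1..<rk E}" and k: "k < rk E"
  shows "chow_cong (chain_prod {G\<in>C. rk G \<le> k} * alpha e ^ (rk E - 1 - k)) (alpha e ^ (rk E - 1))"
  using k
proof (induction k)
  case 0
  have "rk G \<noteq> 0" if "G \<in> C" for G
    using rk_pos proper_flatD(2,3)[OF flat_chain_subset[OF C that]] by auto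
  then have "{G\<in>C. rk G \<le> 0} = {}" by auto
  then show ?case by (simp only:) (simp add: chow_cong_refl)
next
  case (Suc k)
  let ?C = "{G\<in>C. rk G \<le> k}"
  define l where "l = rk E - 1 - Suc k"
  have C': "flat_chain ?C" using flat_chain_mono[OF C] by auto
  have "Suc k \<in> rk ` C" using Suc.prems ranks by auto
  then obtain F where F: "F \<in> C" "rk F = Suc k" by auto
  have Fp: "F \<in> proper_flats" using flat_chain_subset[OF C F(1)] .
  have same_rank: "G = F" if "G \<in> C" "rk G = Suc k" for G
    using that F C flat_subset_eq[of G F] flat_subset_eq[of F G]
      proper_flatD(1,2) flat_chain_subset[OF C] by (metis order_refl subset_chain_def)
  \<comment> \<open>\<open>?U\<close> is the member of rank \<open>k\<close>, or the empty flat when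
    \<open>k = 0\<close>.\<close>
  let ?U = "\<Union>?C"
  have U: "flat ?U \<and> rk ?U = k"
  proof (cases "k = 0")
    case True
    have "?C = {}"
    proof -
      have "rk G \<noteq> 0" if "G \<in> C" for G
        using rk_pos proper_flatD(2,3)[OF flat_chain_subset[OF C that]] by auto
      then show ?thesis using True by auto
    qed
    then show ?thesis using True flat_empty by (simp only:) simp
  next
    case False
    then have "k \<in> rk ` C" using Suc.prems ranks by auto
    then obtain H where H: "H \<in> C" "rk H = k" by auto
    then have U: "?U \<in> ?C" by (intro flat_chain_Union C') auto
    have "rk H \<le> rk ?U" using H by (intro rk_mono) auto
    then show ?thesis
      using U H proper_flatD(1)[OF flat_chain_subset[OF C']] by auto
  qed
  have UF: "?U \<subseteq> F"
  proof
    fix x assume "x \<in> ?U"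
    then obtain G where G: "G \<in> C" "rk G \<le> k" "x \<in> G" by blast
    then have "\<not> F \<subseteq> G" using rk_mono[of F G] F by auto
    then have "G \<subseteq> F" using C F(1) G by (auto simp: subset_chain_def)
    then show "x \<in> F" using G by blast
  qed
  have "F \<noteq> ?U" using U F by auto
  then obtain i where i: "i \<in> F" "i \<notin> ?U" using UF by blast
  have iE: "i \<in> E" using i proper_flatD(2)[OF Fp] by blast
  have rk_iU: "Suc k \<le> rk (insert i ?U)"
  proof -
    have "i \<in> E - ?U" using i(2) iE by (rule DiffI[rotated])
    then have "rk ?U < rk (insert i ?U)"
      using U unfolding flat_def by blast
    then show ?thesis using U by linarith
  qed
  let ?p = "chain_prod ?C * alpha e ^ l"
  have p: "?p \<in> carrier flat_ring"
    by (intro flat_ring_closed flat_chain_subset[OF C'])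
  have kill: "?p * poly_var G \<in> chow_ideal" if G: "G \<in> proper_flats" "i \<in> G" "G \<noteq> F" for G
  proof (cases "\<exists>H\<in>?C. \<not> H \<subseteq> G")
    case True
    then obtain H where H: "H \<in> ?C" "\<not> H \<subseteq> G" by blast
    then have nG: "\<not> G \<subseteq> H" using i G by blast
    have "(chain_prod (?C - {H}) * alpha e ^ l) * (poly_var H * poly_var G) \<in> chow_ideal"
      using H nG G flat_chain_subset[OF C']
      by (intro chow_ideal_mult chow_ideal_incomparable flat_ring_closed) auto
    moreover have "chain_prod ?C = poly_var H * chain_prod (?C - {H})"
      using H flat_chain_finite[OF C'] by (intro prod.remove) auto
    ultimately show ?thesis by (simp add: ac_simps)
  next
    case False
    then have iUG: "insert i ?U \<subseteq> G" using G by blast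
    \<comment> \<open>Another flat of rank \<open>k + 1\<close> containing
      \<open>insert i ?U\<close> would meet \<open>F\<close> in rank at least \<open>k + 1\<close>.
      By submodularity the union of the two would also have rank \<open>k + 1\<close>, so both would
      equal it.\<close>
    have "rk G \<noteq> Suc k"
    proof
      assume rkG: "rk G = Suc k"
      have "rk (insert i ?U) \<le> rk (F \<inter> G)"
        using iUG UF i by (intro rk_mono) auto
      then have "rk (F \<union> G) \<le> Suc k"
        using rk_submodular[of F G] rk_iU rkG F by simp
      then have le: "rk (F \<union> G) \<le> rk F" "rk (F \<union> G) \<le> rk G" using F rkG by simp_all
      have FGE: "F \<union> G \<subseteq> E" using proper_flatD(2) Fp G(1) by blast
      have "F = F \<union> G"
        by (rule flat_subset_eq[OF proper_flatD(1)[OF Fp] Un_upper1 FGE le(1)])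
      moreover have "G = F \<union> G"
        by (rule flat_subset_eq[OF proper_flatD(1)[OF G(1)] Un_upper2 FGE le(2)])
      ultimately show False using G(3) by metis
    qed
    \<comment> \<open>Hence \<open>rk G\<close> is at least \<open>k + 2\<close>, exactly what the
      exponent \<open>l\<close> requires.\<close>
    moreover have "Suc k \<le> rk G" using rk_iU rk_mono[OF iUG] by simp
    ultimately have "alpha e ^ l * poly_var G \<in> chow_ideal"
      by (intro alpha_power_kill G) (simp add: l_def)
    then have "chain_prod ?C * (alpha e ^ l * poly_var G) \<in> chow_ideal"
      by (rule chow_ideal_mult[OF _ flat_ring_chain_prod[OF C']])
    then show ?thesis by (simp add: ac_simps)
  qed
  have "G \<in> C \<and> rk G \<le> Suc k \<longleftrightarrow> G = F \<or> G \<in> C \<and> rk G \<le> k" for G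
    using F same_rank le_Suc_eq by metis
  then have "{G\<in>C. rk G \<le> Suc k} = insert F ?C" by blast
  then have "chain_prod {G\<in>C. rk G \<le> Suc k} = poly_var F * chain_prod ?C"
    using F flat_chain_finite[OF C'] by simp
  then have "chain_prod {G\<in>C. rk G \<le> Suc k} * alpha e ^ l = ?p * poly_var F"
    by (simp add: ac_simps)
  also have "chow_cong \<dots> (?p * alpha i)"
  proof -
    have "alpha i = poly_var F + (\<Sum>G\<in>{G\<in>proper_flats. i \<in> G} - {F}. poly_var G)"
      unfolding alpha_def
      by (rule sum.remove) (use Fp i(1) finite_proper_flats in simp_all)
    then have "?p * alpha i - ?p * poly_var F = (\<Sum>G\<in>{G\<in>proper_flats. i \<in> G} - {F}. ?p * poly_var G)"
      by (simp only: distrib_left sum_distrib_left add_diff_cancel_left')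
    moreover have "\<dots> \<in> chow_ideal" by (intro chow_ideal_sum kill) simp_all
    ultimately have "chow_cong (?p * alpha i) (?p * poly_var F)"
      unfolding chow_cong_def by (simp only:)
    then show ?thesis by (rule chow_cong_sym)
  qed
  also have "chow_cong \<dots> (?p * alpha e)"
    by (intro chow_cong_mult chow_cong_alpha iE e p)
  also have "?p * alpha e = chain_prod ?C * alpha e ^ (rk E - 1 - k)"
  proof -
    have "rk E - 1 - k = Suc l" using Suc.prems by (simp add: l_def)
    then show ?thesis by (simp add: ac_simps)
  qed
  also have "chow_cong \<dots> (alpha e ^ (rk E - 1))"
    using Suc by simp
  finally show ?case by (simp add: l_def)
qed

lemma flag_cong_alpha_power_full:
  assumes C: "flat_chain C" and ranks: "rk ` C = {1..<rk E}"
  shows "chow_cong (chain_prod C) (alpha e ^ (rk E - 1))"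
proof -
  have pos: "0 < rk E" using rk_pos[of E] e by auto
  have "{G\<in>C. rk G \<le> rk E - 1} = C"
    using proper_flatD(5)[OF flat_chain_subset[OF C]] by fastforce
  then show ?thesis
    using flag_cong_alpha_power[OF C ranks, of "rk E - 1"] pos by simp
qed

lemma flat_chain_ranks_subset:
  assumes C: "flat_chain C"
  shows "rk ` C \<subseteq> {1..<rk E}" "inj_on rk C"
proof -
  have "rk G \<in> {1..<rk E}" if "G \<in> C" for G
    using proper_flatD[OF flat_chain_subset[OF C that]] rk_pos[of G] by auto
  then show "rk ` C \<subseteq> {1..<rk E}" by blast
  show "inj_on rk C"
  proof (rule inj_onI)
    fix G H assume GH: "G \<in> C" "H \<in> C" "rk G = rk H"
    then have "G \<subseteq> H \<or> H \<subseteq> G" using C by (auto simp: subset_chain_def)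
    then show "G = H"
      using flat_subset_eq[of G H] flat_subset_eq[of H G] GH proper_flatD(1,2)
        flat_chain_subset[OF C] by auto
  qed
qed

text \<open>A chain of \<open>rk E - 1\<close> proper flats has distinct ranks, so it is a complete
  flag and its product is congruent to the power of \<open>alpha e\<close>.\<close>

lemma chain_comb_top:
  assumes "chain_comb S (rk E - 1) p" "0 \<in> S" "\<And>a b. a \<in> S \<Longrightarrow> b \<in> S \<Longrightarrow> a + b \<in> S"
  shows "\<exists>c\<in>S. chow_cong p (poly_const c * alpha e ^ (rk E - 1))"
  using assms(1)
proof (induction rule: chain_comb.induct)
  case (ideal p)
  then show ?case using assms(2) by (intro bexI[of _ 0]) (auto simp: chow_cong_def)
next
  case (add C a p)
  then obtain c where c: "c \<in> S" "chow_cong p (poly_const c * alpha e ^ (rk E - 1))" by blast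
  note C = flat_chain_ranks_subset[OF add.hyps(1)]
  have "card (rk ` C) = card {1..<rk E}"
    using card_image[OF C(2)] add.hyps(2) by simp
  then have "rk ` C = {1..<rk E}" using C(1) by (intro card_subset_eq) auto
  then have "chow_cong (poly_const a * chain_prod C) (poly_const a * alpha e ^ (rk E - 1))"
    using add.hyps(1) by (intro chow_cong_mult flag_cong_alpha_power_full flat_ring_const)
  from chow_cong_add[OF this c(2)]
  have "chow_cong (poly_const a * chain_prod C + p) (poly_const (a + c) * alpha e ^ (rk E - 1))"
    by (simp add: poly_const_add distrib_right)
  then show ?case using add.hyps(3) c(1) assms(3) by blast
qed

lemma top_cong_deg_poly:
  assumes "chow_cong p (poly_const c * alpha e ^ (rk E - 1))"
  shows "deg_poly p = c"
  using deg_poly_cong[OF assms] deg_poly_alpha_power[OF e] by (simp only: deg_poly_scale mult_1_right)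

text \<open>The top piece is spanned by the power of \<open>alpha e\<close>, and
  \<open>deg_poly\<close> reads off the coefficient. Injectivity and uniqueness of the degree map
  rest on this.\<close>

lemma homogeneous_top_cong:
  assumes "p \<in> carrier flat_ring" "homogeneous (rk E - 1) p"
  shows "chow_cong p (poly_const (deg_poly p) * alpha e ^ (rk E - 1))"
  using chain_comb_top[OF chain_comb_homogeneous[OF assms]] top_cong_deg_poly by auto

lemma deg_poly_nonneg:
  assumes "chain_comb {0..} (rk E - 1) p"
  shows "deg_poly p \<ge> 0"
  using chain_comb_top[OF assms] top_cong_deg_poly by fastforce

text \<open>If rank \<open>k\<close> is skipped, a flat of rank \<open>k\<close> fits between the
  union \<open>A\<close> of the lower members and the intersection \<open>B\<close> of the higher
  ones, against maximality.\<close>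

lemma maxchain_ranks:
  assumes max: "subset.maxchain proper_flats C"
  shows "rk ` C = {1..<rk E}"
proof (rule ccontr)
  have C: "flat_chain C" using max by (simp add: subset.maxchain_def)
  assume "rk ` C \<noteq> {1..<rk E}"
  then have "\<not> {1..<rk E} \<subseteq> rk ` C"
    using flat_chain_ranks_subset(1)[OF C] by blast
  then obtain k where k: "1 \<le> k" "k < rk E" "k \<notin> rk ` C"
    by (meson atLeastLessThan_iff subsetI)
  define A where "A = \<Union>{G\<in>C. rk G < k}"
  \<comment> \<open>The default \<open>E\<close> stands in for the intersection of the empty
    family.\<close>
  define B where "B = (if {G\<in>C. k < rk G} = {} then E else \<Inter>{G\<in>C. k < rk G})"
  have "A \<subseteq> E \<and> rk A < k"
  proof (cases "{G\<in>C. rk G < k} = {}")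
    case True
    then have "A = {}" by (simp only: A_def) simp
    then show ?thesis using k by simp
  next
    case False
    then have "A \<in> {G\<in>C. rk G < k}"
      unfolding A_def using flat_chain_mono[OF C] by (intro flat_chain_Union) auto
    then show ?thesis using proper_flatD(2)[OF flat_chain_subset[OF C]] by auto
  qed
  then have A: "A \<subseteq> E" "rk A < k" by auto
  have "flat B \<and> k < rk B \<and> (\<forall>G\<in>C. k < rk G \<longrightarrow> B \<subseteq> G) \<and> (B = E \<or> B \<in> C)"
  proof (cases "{G\<in>C. k < rk G} = {}")
    case True
    then have "B = E" by (simp only: B_def) simp
    then show ?thesis using k True flat_ground by auto
  next
    case False
    then have B_eq: "B = \<Inter>{G\<in>C. k < rk G}" by (simp only: B_def) simp
    have "B \<in> {G\<in>C. k < rk G}"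
      unfolding B_eq using flat_chain_mono[OF C] False by (intro flat_chain_Inter) auto
    moreover have "B \<subseteq> G" if "G \<in> C" "k < rk G" for G
      using that unfolding B_eq by blast
    ultimately show ?thesis
      using proper_flatD(1)[OF flat_chain_subset[OF C]] by auto
  qed
  then have B: "flat B" "k < rk B" "\<And>G. G \<in> C \<Longrightarrow> k < rk G \<Longrightarrow> B \<subseteq> G" "B = E \<or> B \<in> C"
    by auto
  have BE: "B \<subseteq> E" using B(1) by (simp add: flat_def)
  have AB: "A \<subseteq> B"
  proof
    fix x assume "x \<in> A"
    then obtain G where G: "G \<in> C" "rk G < k" "x \<in> G" unfolding A_def by blast
    have "G \<subseteq> B"
    proof (cases "B = E")
      case False
      then have "B \<in> C" using B by blast
      then have "G \<subseteq> B \<or> B \<subseteq> G" using C G by (auto simp: subset_chain_def)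
      then show ?thesis using rk_mono[of B G] B(2) G by auto
    qed (use proper_flatD(2)[OF flat_chain_subset[OF C G(1)]] in simp)
    then show "x \<in> B" using G by blast
  qed
  obtain I where I: "I \<in> Ind" "I \<subseteq> A" "card I = rk A"
    using rk_attained by blast
  obtain J where J: "J \<in> Ind" "I \<subseteq> J" "J \<subseteq> B" "card J = rk B"
    using indep_extend[OF I(1), of B] I AB by blast
  \<comment> \<open>Interpolating between maximum independent subsets of \<open>A\<close> and
    \<open>B\<close> gives an independent set of size \<open>k\<close>; its closure \<open>F\<close>
    is the missing flat.\<close>
  obtain S where S: "I \<subseteq> S" "S \<subseteq> J" "card S = k"
    using exists_subset_between[of I k J] I J A B indep_finite by auto
  have S': "rk S = k" "S \<subseteq> B"
    using S J rk_indep[OF indep_subset[OF J(1) S(2)]] by auto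
  obtain F where F: "flat F" "S \<subseteq> F" "rk F = rk S" "\<forall>x\<in>E. rk (insert x S) = rk S \<longrightarrow> x \<in> F"
    using ex_flat_cover[of S] S' BE by blast
  \<comment> \<open>Elements of \<open>A\<close> do not raise the rank of \<open>I\<close>, hence
    not that of \<open>S\<close>, so they lie in the closure.\<close>
  have AF: "A \<subseteq> F"
  proof
    fix x assume x: "x \<in> A"
    have "rk (insert x I) \<le> rk A" using x I by (intro rk_mono) auto
    then have "rk (insert x I) = rk I"
      using rk_mono[OF subset_insertI[of I x]] I rk_indep[OF I(1)] by simp
    then have "rk (insert x (I \<union> S)) = rk (I \<union> S)" by (rule rk_Un_eq)
    then show "x \<in> F" using F x A S(1) by (auto simp: Un_absorb1)
  qed
  have FE: "F \<subseteq> E" using F(1) by (simp add: flat_def)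
  \<comment> \<open>An element of \<open>F\<close> does not raise the rank of \<open>S\<close>,
    hence not that of the flat \<open>B\<close> containing \<open>S\<close>.\<close>
  have FB: "F \<subseteq> B"
  proof (rule ccontr)
    assume "\<not> F \<subseteq> B"
    then obtain x where x: "x \<in> F" "x \<notin> B" by blast
    have "rk (insert x S) \<le> rk F" using x F by (intro rk_mono) auto
    then have "rk (insert x S) = rk S"
      using rk_mono[OF subset_insertI[of S x]] F by simp
    then have "rk (insert x (S \<union> B)) = rk (S \<union> B)" by (rule rk_Un_eq)
    then have "rk (insert x B) = rk B" using S'(2) by (simp add: Un_absorb1)
    moreover have "x \<in> E - B" using x FE by blast
    ultimately show False using B(1) unfolding flat_def by (metis less_irrefl)
  qed
  have Fp: "F \<in> proper_flats" using F k S' by (auto simp: proper_flats_def)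
  have "F \<subseteq> G \<or> G \<subseteq> F" if G: "G \<in> C" for G
  proof (cases "rk G < k")
    case True
    then have "G \<subseteq> A" using G unfolding A_def by blast
    then show ?thesis using AF by blast
  next
    case False
    then have "k < rk G" using k(3) G by (metis image_eqI linorder_neqE_nat)
    then show ?thesis using B(3)[OF G] FB by blast
  qed
  then have "flat_chain (insert F C)" using C Fp by (auto simp: subset_chain_def)
  moreover have "F \<notin> C" using F S' k by auto
  ultimately show False using max unfolding subset.maxchain_def by blast
qed

text \<open>A maximal chain exists by Hausdorff's principle, and its class spans the top piece.
  Linearity and the value 1 there determine \<open>f\<close>.\<close>

lemma degree_map_eq_deg_poly:
  assumes f: "is_degree_map f" and p: "p \<in> carrier flat_ring" "homogeneous (rk E - 1) p"
  shows "f (chow_class p) = deg_poly p"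
proof -
  let ?c = "deg_poly p"
  obtain C where max: "subset.maxchain proper_flats C"
    using subset.Hausdorff by blast
  then have C: "flat_chain C" by (simp add: subset.maxchain_def)
  have Cq: "chain_prod C \<in> carrier flat_ring" by (rule flat_ring_chain_prod[OF C])
  have "card C = card {1..<rk E}"
    using maxchain_ranks[OF max] card_image[OF flat_chain_ranks_subset(2)[OF C]] by simp
  then have Ch: "homogeneous (rk E - 1) (chain_prod C)"
    using homogeneous_prod_vars[OF flat_chain_finite[OF C]] by simp
  have "chow_cong p (poly_const ?c * alpha e ^ (rk E - 1))"
    by (rule homogeneous_top_cong[OF p])
  also have "chow_cong \<dots> (poly_const ?c * chain_prod C)"
    by (intro chow_cong_mult chow_cong_sym[OF flag_cong_alpha_power_full] C maxchain_ranks[OF max]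
        flat_ring_const)
  finally have "chow_class p = chow_scale ?c (chow_class (chain_prod C))"
    by (simp add: chow_class_eq_iff chow_class_scale Cq)
  moreover have "chow_class (chain_prod C) \<in> chow_graded (rk E - 1)"
    by (rule chow_gradedI[OF Cq Ch])
  moreover have "f (chow_class (chain_prod C)) = 1"
  proof -
    have "chow_class (chain_prod C) = (\<Otimes>\<^bsub>chow_ring\<^esub>G\<in>C. chow_class (poly_var G))"
      using flat_chain_finite[OF C] flat_chain_subset[OF C]
      by (subst chow_class_prod) (auto intro: flat_ring_var)
    then show ?thesis using f max by (simp add: is_degree_map_def Let_def)
  qed
  ultimately show ?thesis using f by (simp add: is_degree_map_def Let_def)
qed

text \<open>\<open>deg_poly\<close> descends to a degree map, and
  \<open>degree_map_eq_deg_poly\<close> excludes any other; this resolves the definite description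
  in \<open>deg\<close>.\<close>

lemma is_degree_map_deg: "is_degree_map deg"
proof -
  let ?d = "rk E - 1"
  \<comment> \<open>Any representative will do, homogeneous or not, since \<open>deg_poly\<close> is
    constant on congruence classes.\<close>
  define f where "f = restrict (\<lambda>a. deg_poly (SOME p. a = chow_class p)) (chow_graded ?d)"
  have f: "f (chow_class p) = deg_poly p" if "p \<in> carrier flat_ring" "homogeneous ?d p" for p
  proof -
    have "chow_class p = chow_class (SOME q. chow_class p = chow_class q)"
      by (rule someI_ex) auto
    then have "deg_poly (SOME q. chow_class p = chow_class q) = deg_poly p"
      unfolding chow_class_eq_iff using deg_poly_cong by force
    then show ?thesis using chow_gradedI[OF that] by (simp add: f_def)
  qed
  have "is_degree_map f"
    unfolding is_degree_map_def Let_def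
  proof (intro conjI ballI allI impI)
    show "f \<in> extensional (chow_graded ?d)" by (simp add: f_def)
    show "bij_betw f (chow_graded ?d) UNIV"
    proof (rule bij_betwI')
      fix a b assume ab: "a \<in> chow_graded ?d" "b \<in> chow_graded ?d"
      then obtain p q where p: "p \<in> carrier flat_ring" "homogeneous ?d p" "a = chow_class p"
        and q: "q \<in> carrier flat_ring" "homogeneous ?d q" "b = chow_class q"
        by (metis chow_gradedE)
      have "chow_cong p q" if "deg_poly p = deg_poly q"
        using homogeneous_top_cong[OF p(1,2)] homogeneous_top_cong[OF q(1,2)] that
        by (metis chow_cong_sym chow_cong_trans)
      then show "(f a = f b) = (a = b)"
        using p q f deg_poly_cong by (auto simp: chow_class_eq_iff)
    next
      fix c :: real
      \<comment> \<open>Multiples of the power of \<open>alpha e\<close> attain every real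
        value.\<close>
      let ?p = "poly_const c * alpha e ^ ?d"
      have p: "?p \<in> carrier flat_ring" by (intro flat_ring_closed)
      have h: "homogeneous ?d ?p"
        unfolding alpha_def by (intro homogeneous_scale homogeneous_power homogeneous_sum homogeneous_var)
      have "f (chow_class ?p) = c"
        using f[OF p h] top_cong_deg_poly[OF chow_cong_refl] by simp
      then show "\<exists>a\<in>chow_graded ?d. c = f a"
        using chow_gradedI[OF p h] by metis
    qed simp
  next
    fix a b assume ab: "a \<in> chow_graded ?d" "b \<in> chow_graded ?d"
    then obtain p q where p: "p \<in> carrier flat_ring" "homogeneous ?d p" "a = chow_class p"
      and q: "q \<in> carrier flat_ring" "homogeneous ?d q" "b = chow_class q"
      by (metis chow_gradedE)
    then show "f (a \<oplus>\<^bsub>chow_ring\<^esub> b) = f a + f b"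
      by (simp add: chow_class_add f flat_ring_add homogeneous_add deg_poly_add)
  next
    fix c a assume "a \<in> chow_graded ?d"
    then obtain p where p: "p \<in> carrier flat_ring" "homogeneous ?d p" "a = chow_class p"
      by (metis chow_gradedE)
    then show "f (chow_scale c a) = c * f a"
      by (simp add: chow_class_scale f flat_ring_mult flat_ring_const homogeneous_scale deg_poly_scale)
  next
    fix C assume max: "subset.maxchain proper_flats C"
    then have C: "flat_chain C" by (simp add: subset.maxchain_def)
    have "card C = card {1..<rk E}"
      using maxchain_ranks[OF max] card_image[OF flat_chain_ranks_subset(2)[OF C]] by simp
    then have "homogeneous ?d (chain_prod C)"
      using homogeneous_prod_vars[OF flat_chain_finite[OF C]] by simp
    then have "f (chow_class (chain_prod C)) = deg_poly (chain_prod C)"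
      by (intro f flat_ring_chain_prod C)
    also have "\<dots> = 1"
      using deg_poly_cong[OF flag_cong_alpha_power_full[OF C maxchain_ranks[OF max]]]
      using deg_poly_alpha_power[OF e] by (simp only:)
    finally show "f (\<Otimes>\<^bsub>chow_ring\<^esub>G\<in>C. chow_class (poly_var G)) = 1"
      using flat_chain_finite[OF C] flat_chain_subset[OF C]
      by (subst chow_class_prod) (auto intro: flat_ring_var)
  qed
  moreover have "g = f" if g: "is_degree_map g" for g
  proof (rule extensionalityI)
    show "g \<in> extensional (chow_graded ?d)" "f \<in> extensional (chow_graded ?d)"
      using g by (auto simp: is_degree_map_def Let_def f_def)
    fix a assume "a \<in> chow_graded ?d"
    then show "g a = f a"
      by (elim chow_gradedE) (simp add: f degree_map_eq_deg_poly[OF g])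
  qed
  ultimately show ?thesis
    unfolding deg_def by (rule theI)
qed

lemma shRVol_eq: "shRVol = deg_poly (rank_divisor ^ (rk E - 1))"
proof -
  have "(\<Oplus>\<^bsub>chow_ring\<^esub>F\<in>proper_flats. chow_scale (real (rk F)) (chow_class (poly_var F))) =
      (\<Oplus>\<^bsub>chow_ring\<^esub>F\<in>proper_flats. chow_class (poly_const (real (rk F)) * poly_var F))"
  proof -
    interpret ring_hom_cring flat_ring chow_ring chow_class by (rule chow_class_hom)
    show ?thesis
      by (intro S.finsum_cong')
        (auto simp: chow_class_scale flat_ring_var intro!: chow_class_closed flat_ring_mult flat_ring_const flat_ring_var)
  qed
  also have "\<dots> = chow_class rank_divisor"
    unfolding rank_divisor_def by (intro chow_class_sum finite_proper_flats flat_ring_closed)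
  finally have "shRVol = deg (chow_class (rank_divisor ^ (rk E - 1)))"
    by (simp add: shRVol_def chow_class_power flat_ring_rank_divisor)
  also have "\<dots> = deg_poly (rank_divisor ^ (rk E - 1))"
  proof (rule degree_map_eq_deg_poly[OF is_degree_map_deg])
    show "rank_divisor ^ (rk E - 1) \<in> carrier flat_ring"
      by (intro flat_ring_power flat_ring_rank_divisor)
    show "homogeneous (rk E - 1) (rank_divisor ^ (rk E - 1))"
      unfolding rank_divisor_def
      by (intro homogeneous_power homogeneous_sum homogeneous_scale homogeneous_var)
  qed
  finally show ?thesis .
qed

section \<open>The shifted rank volume\<close>

lemma sum_card_cong:
  "chow_cong (\<Sum>F\<in>proper_flats. poly_const (real (card F)) * poly_var F)
    (poly_const (real (card E)) * alpha e)"
  using chow_cong_additive_weight[OF e, of "\<lambda>_. 1"] by simp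

text \<open>The cardinality is additive, so the rank divisor is congruent to \<open>card E\<close>
  times \<open>alpha e\<close>.\<close>

lemma shRVol_free_flats:
  assumes "\<And>F. F \<in> proper_flats \<Longrightarrow> rk F = card F"
  shows "shRVol = real (card E) ^ (rk E - 1)"
proof -
  have "rank_divisor = (\<Sum>F\<in>proper_flats. poly_const (real (card F)) * poly_var F)"
    unfolding rank_divisor_def by (intro sum.cong) (simp_all add: assms)
  then have "chow_cong rank_divisor (poly_const (real (card E)) * alpha e)"
    using sum_card_cong by simp
  then have "chow_cong (rank_divisor ^ (rk E - 1)) ((poly_const (real (card E)) * alpha e) ^ (rk E - 1))"
    by (intro chow_cong_power flat_ring_rank_divisor flat_ring_closed)
  then have "chow_cong (rank_divisor ^ (rk E - 1))
      (poly_const (real (card E) ^ (rk E - 1)) * alpha e ^ (rk E - 1))"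
    by (simp only: power_mult_distrib poly_const_power)
  then show ?thesis
    by (simp add: shRVol_eq top_cong_deg_poly)
qed

text \<open>The rank function is bounded by \<open>S \<mapsto> card S - of_bool (C \<subseteq> S)\<close>, the rank function of the
  matroid whose only circuit is \<open>C\<close>; the divisor of the latter is \<open>(card E - 1) \<alpha> + h\<^sub>C\<close>.\<close>

lemma shRVol_dependent_less:
  assumes C: "e \<in> C" "C \<subseteq> E" "C \<notin> Ind" "card C \<le> rk E"
  shows "shRVol < real (card E) ^ (rk E - 1)"
proof -
  let ?d = "rk E - 1"
  \<comment> \<open>A set containing the dependent set \<open>C\<close> is dependent.\<close>
  have rk_dep: "rk F < card F" if "C \<subseteq> F" "F \<subseteq> E" for F
  proof -
    have fin: "finite F" using that finite_ground finite_subset by blast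
    obtain Y where Y: "Y \<in> Ind" "Y \<subseteq> F" "card Y = rk F" using rk_attained by blast
    have "Y \<noteq> F" using Y C that indep_subset by blast
    then show ?thesis using Y fin by (metis psubset_card_mono psubsetI)
  qed
  have rkC: "rk C < rk E" "1 \<le> rk C"
    using rk_dep[of C] C rk_pos[of C] by (auto simp: Suc_le_eq)
  have cardE: "1 \<le> card E" using e finite_ground by (metis One_nat_def Suc_leI card_gt_0_iff empty_iff)
  let ?c = "real (card E) - 1"
  define D where "D = (\<Sum>F\<in>proper_flats. poly_const (real (card F) - of_bool (C \<subseteq> F)) * poly_var F)"
  let ?D' = "poly_const ?c * alpha e + eta C e"
  have D_carrier: "D \<in> carrier flat_ring" unfolding D_def by (intro flat_ring_closed)
  have D'_carrier: "?D' \<in> carrier flat_ring" by (intro flat_ring_closed)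
  have cong: "chow_cong D ?D'"
  proof -
    have "D = (\<Sum>F\<in>proper_flats. poly_const (real (card F)) * poly_var F) - (alpha e - eta C e)"
      using alpha_eq_eta[OF C(1)]
      by (simp only: D_def poly_const_diff left_diff_distrib sum_subtractf sum_poly_const_of_bool) simp
    moreover have "?D' = poly_const (real (card E)) * alpha e - (alpha e - eta C e)"
      by (simp add: poly_const_diff algebra_simps)
    ultimately show ?thesis
      by (simp only: chow_cong_diff[OF sum_card_cong chow_cong_refl])
  qed
  \<comment> \<open>Nefness passes to \<open>D\<close> along the congruence with \<open>?D'\<close>,
    a nonnegative combination of \<open>alpha e\<close> and \<open>eta C e\<close>.\<close>
  have nef_D: "chain_comb {0..} (Suc (card K)) (D * chain_prod K)" if K: "flat_chain K" for K
  proof -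
    have "chain_comb {0..} (Suc (card K))
        (poly_const ?c * (alpha e * chain_prod K) + eta C e * chain_prod K)"
      unfolding alpha_eq_eta_ground using C e cardE
      by (intro chain_comb_add chain_comb_scale chain_comb_eta K) auto
    moreover have "chow_cong (D * chain_prod K)
        (poly_const ?c * (alpha e * chain_prod K) + eta C e * chain_prod K)"
      using chow_cong_mult[OF cong flat_ring_chain_prod[OF K]] by (simp add: algebra_simps)
    ultimately show ?thesis by (rule chain_comb_cong)
  qed
  \<comment> \<open>Coefficients are compared flat by flat, with \<open>rk_dep\<close> supplying the
    extra 1 on flats containing \<open>C\<close>. The empty chain turns
    \<open>chain_comb_linear_form\<close> into a statement about the linear form alone.\<close>
  have eff: "chain_comb {0..} 1 (D - rank_divisor)"
  proof -
    have "chain_comb {0..} (Suc (card ({} :: 'a set set)))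
      ((\<Sum>F\<in>proper_flats. poly_const (real (card F) - of_bool (C \<subseteq> F) - real (rk F)) * poly_var F)
        * chain_prod {})"
    proof (rule chain_comb_linear_form)
      fix F assume F: "F \<in> proper_flats"
      have "real (rk F) + of_bool (C \<subseteq> F) \<le> real (card F)"
        using rk_dep[of F] rk_le_card[of F] proper_flatD[OF F] by (cases "C \<subseteq> F") auto
      then show "real (card F) - of_bool (C \<subseteq> F) - real (rk F) \<in> {0..}" by simp
    qed (auto simp: subset_chain_def)
    moreover have "D - rank_divisor =
        (\<Sum>F\<in>proper_flats. poly_const (real (card F) - of_bool (C \<subseteq> F) - real (rk F)) * poly_var F)"
      by (simp only: D_def rank_divisor_def poly_const_diff left_diff_distrib sum_subtractf)
    ultimately show ?thesis by simp
  qed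
  have "chain_comb {0..} ?d (D ^ ?d - rank_divisor ^ ?d)"
  proof -
    \<comment> \<open>These are the summands of the factorization of
      \<open>D ^ ?d - rank_divisor ^ ?d\<close>: the effective difference times powers of two nef
      forms.\<close>
    have summand: "chain_comb {0..} ?d (D ^ i * (rank_divisor ^ (?d - Suc i) * (D - rank_divisor)))"
      if i: "i < ?d" for i
    proof -
      have "chain_comb {0..} (1 + (?d - Suc i) + i)
          (D ^ i * (rank_divisor ^ (?d - Suc i) * (D - rank_divisor)))"
        by (intro chain_comb_power_mult eff flat_ring_rank_divisor D_carrier nef_D
            chain_comb_rank_divisor[OF _ e]) auto
      moreover have "1 + (?d - Suc i) + i = ?d" using i by simp
      ultimately show ?thesis by (simp only:)
    qed
    have "D ^ ?d - rank_divisor ^ ?d =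
        (\<Sum>i<?d. D ^ i * (rank_divisor ^ (?d - Suc i) * (D - rank_divisor)))"
      by (simp add: power_diff_sumr2 sum_distrib_left sum_distrib_right ac_simps)
    also have "chain_comb {0..} ?d \<dots>"
      by (intro chain_comb_sum summand) simp
    finally show ?thesis .
  qed
  then have "deg_poly (rank_divisor ^ ?d) \<le> deg_poly (D ^ ?d)"
    using deg_poly_nonneg by (fastforce simp: deg_poly_diff)
  also have "\<dots> = deg_poly (?D' ^ ?d)"
    by (intro deg_poly_cong chow_cong_power cong D_carrier D'_carrier)
  also have "\<dots> < (?c + 1) ^ ?d"
    using cardE by (intro deg_poly_alpha_eta_power_less C rkC e) auto
  finally show ?thesis by (simp add: shRVol_eq)
qed

end

end

section \<open>Uniform matroids and the comparison\<close>

lemma rk_uniform: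
  assumes "finite E" "X \<subseteq> E"
  shows "matroid.rk (uniform r E) X = min (card X) r"
proof -
  interpret matroid E "uniform r E" by (rule matroid_uniform[OF assms(1)])
  have fin: "finite X" using assms finite_subset by blast
  obtain Y where Y: "Y \<in> uniform r E" "Y \<subseteq> X" "card Y = rk X" using rk_attained by blast
  then have "rk X \<le> min (card X) r"
    using rk_le_card[OF fin] by (auto simp: uniform_def)
  obtain Z where Z: "Z \<subseteq> X" "card Z = min (card X) r"
    using obtain_subset_with_card_n[of "min (card X) r" X] by auto
  then have "Z \<in> uniform r E" using assms by (auto simp: uniform_def)
  then have "min (card X) r \<le> rk X" using card_le_rk[of Z X] Z by simp
  with \<open>rk X \<le> min (card X) r\<close> show ?thesis by (rule antisym)
qed

text \<open>A proper flat has rank below \<open>r\<close>, so the minimum in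
  \<open>rk_uniform\<close> is its cardinality and \<open>shRVol_free_flats\<close> applies.\<close>

lemma shRVol_uniform:
  assumes "finite E" "1 \<le> r" "r \<le> card E"
  shows "matroid.shRVol E (uniform r E) = real (card E) ^ (r - 1)"
proof -
  interpret U: matroid E "uniform r E" by (rule matroid_uniform[OF assms(1)])
  have rkE: "U.rk E = r" using rk_uniform[OF assms(1), of E r] assms by simp
  obtain e where e: "e \<in> E" using assms by fastforce
  have loopless: U.loopless
    unfolding U.loopless_def U.flat_def using assms by (auto simp: rk_uniform)
  have "U.rk F = card F" if F: "F \<in> U.proper_flats" for F
    using U.proper_flatD(2,5)[OF F] rkE rk_uniform[OF assms(1), of F r] by auto
  from U.shRVol_free_flats[OF loopless e this] show ?thesis by (simp add: rkE)
qed

theorem theorem5p5: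
  fixes E :: "'a set" and Ind :: "'a set set"
    and scale :: "'k::field \<Rightarrow> 'v::ab_group_add \<Rightarrow> 'v"
    and r n :: nat
  assumes "matroid E Ind"
    and "matroid.loopless E Ind"
    and "realizable_in scale E Ind"
    and "matroid.rk Ind E = r"
    and "r \<ge> 1"
    and "card E = n"
  shows "matroid.shRVol E Ind \<le> matroid.shRVol E (uniform r E) \<and>
    matroid.shRVol E (uniform r E) = real n ^ (r - 1) \<and>
    (matroid.shRVol E Ind = matroid.shRVol E (uniform r E) \<longleftrightarrow> Ind = uniform r E)"
proof -
  interpret matroid E Ind by fact
  have "r \<le> card E" using rk_le_card[OF finite_ground] assms(4) by simp
  then have U: "matroid.shRVol E (uniform r E) = real n ^ (r - 1)"
    using shRVol_uniform[OF finite_ground assms(5)] assms(6) by simp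
  have "shRVol < real n ^ (r - 1)" if "Ind \<noteq> uniform r E"
  proof -
    \<comment> \<open>Independent sets never exceed the rank, so a matroid other than the uniform
      one has a dependent set \<open>C\<close> of at most \<open>r\<close> elements.\<close>
    have "Ind \<subseteq> uniform r E"
      using indep_subset_ground card_le_rk assms(4) by (auto simp: uniform_def)
    with that obtain C where "C \<in> uniform r E" and C: "C \<notin> Ind" by blast
    then have CE: "C \<subseteq> E" "card C \<le> r" by (simp_all add: uniform_def)
    \<comment> \<open>An element of \<open>C\<close> serves as the reference element for both
      \<open>alpha\<close> and \<open>eta\<close>.\<close>
    have "C \<noteq> {}" using C indep_empty by metis
    then obtain e where "e \<in> C" by blast
    then show ?thesis
      using shRVol_dependent_less[of e C] C CE assms by auto
  qed
  then show ?thesis using U by force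
qed

end
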